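(* Assume Assumptions 1, 2, 3 and that $H$ is degenerate. Let $s_n^2=\operatorname{Var}(S_n)$ and $\sigma_n^2=\sum_{i\ne k}E H_{i\tilde k}^2$. If for some $\delta>0$ and sequence $m=m(n)$, $$\tau_4^m\mathbf H_2^2+(\hat\tau_4^m+\tau_{2,2}^m)\mathbf H_{2+\delta}^2\beta_4(m)^{\frac{\delta}{2+\delta}}+\tau_{2,2}^m\gamma_{m,1}=o(\sigma_n^2),$$ then $s_n^2=(2+o(1))\sigma_n^2$.
   Context: For each $n$, $\mathcal I_n$ is a finite index set with $|\mathcal I_n|=n$, equipped with a metric $\mathbf d:\mathcal I_n\times\mathcal I_n\to[0,\infty]$, and $\{X_i:i\in\mathcal I_n\}$ are random vectors in $\mathbb R^d$ on a probability space $(\Omega,\mathcal F,P)$. For $\mathcal I_1,\mathcal I_2\subset\mathcal I_n$, $\mathbf d(\mathcal I_1,\mathcal I_2)=\inf_{i\in\mathcal I_1,j\in\mathcal I_2}\mathbf d(i,j)$. The $\beta$-mixing coefficient of sub-$\sigma$-algebras is $\beta(\mathcal F_1,\mathcal F_2)=\sup\frac12\sum_{i}\sum_{j}|P(A_i\cap B_j)-P(A_i)P(B_j)|$, the sup over finite partitions $\{A_i\}\subset\mathcal F_1$, $\{B_j\}\subset\mathcal F_2$ of $\Omega$. $\mathcal P_n(n_1,n_2,m)$ is the set of pairs $(\mathcal I_1,\mathcal I_2)$ of subsets of $\mathcal I_n$ with $|\mathcal I_1|\le n_1$, $|\mathcal I_2|\le n_2$, $\mathbf d(\mathcal I_1,\mathcal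 I_2)\ge m$ ($n_1,n_2$ may be $\infty$). Assumption 1: $\mathbf d(i,j)\ge 1$ for all $n$ and all $i\ne j$. Assumption 2: there are numbers $\beta_n(n_1,n_2,m)$ with $\sup_{(\mathcal I_1,\mathcal I_2)\in\mathcal P_n(n_1,n_2,m)}\beta(\sigma(X_i:i\in\mathcal I_1),\sigma(X_i:i\in\mathcal I_2))\le\beta_n(n_1,n_2,m)$; $\beta(n_1,n_2,m):=\sup_n\beta_n(n_1,n_2,m)$; $\beta_4(m)=\max\{\beta(q_1,q_2,m):q_1,q_2\in\mathbb N^+,\ q_1+q_2=4\}$. Assumption 3: the kernel $H=H_n:\mathbb R^d\times\mathbb R^d\to\mathbb R$ is measurable and symmetric, and $E H_n(X_i,\tilde X_j)^2<\infty$ for all $i\ne j$ and $n$. Degenerate: $E H(X_k,x)=0$ for all $k\in\mathcal I_n$ and all $x$ in the support. Notation: $H_{ij}=H(X_i,X_j)$; for $i\neq j$, $\tilde X_j$ denotes a random vector with the law of $X_j$ independent of $X_i$, and $H_{i\tilde j}=H(X_i,\tilde X_j)$; $\mathbf H_p=\sup_{i\ne j}\max\{\|H_{ij}\|_p,\|H_{i\tilde j}\|_p\}$. $S_n=\sum_{i\ne k}H(X_i,X_k)$. $\mathcal N_i^m=\{j:\mathbf d(i,j)\le m\}$. $\Gamma^{i,j}(x,y)=E[H(X_i,x)H(X_j,y)]$, $\Gamma^{i,j}_{k_1k_2}=\Gamma^{i,j}(X_{k_1},X_{k_2})$, $\gamma_{m,1}=\sup\{|E\Gamma^{i,j}_{k_1k_2}|: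 i,j,k_1,k_2\in\mathcal I_n,\ j\in\mathcal N_i^m,\ k_1\ne k_2\}$. Sparsity: for $\mathbf i=(i_1,\dots,i_q)\in\mathcal I_n^q$, entries are $m$-connected in $\mathbf i$ if joined by a chain of entries of $\mathbf i$ with consecutive distances $\le m$; the $m$-profile $\pi_m(\mathbf i)$ is the decreasingly ordered vector of the numbers of entries (counting repeats) in each equivalence class; $\tau^m_{q_1,\dots,q_S}=\#\{\mathbf i\in\mathcal I_n^q:\pi_m(\mathbf i)=(q_1,\dots,q_S)\}$, and $\hat\tau_4^m=\tau^m_{3,1}+\tau^m_{2,1,1}+\tau^m_{1,1,1,1}$. *)

theory Defs
  imports "HOL-Probability.Probability" "HOL-Library.Landau_Symbols" "HOL-Library.Multiset"
begin

text \<open>d(I1,I2) = inf over i in I1, j in I2 of d(i,j); the infimum of the empty set is infinity.\<close>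
definition set_dist :: "('a \<Rightarrow> 'a \<Rightarrow> ereal) \<Rightarrow> 'a set \<Rightarrow> 'a set \<Rightarrow> ereal" where
  "set_dist d A B = (INF i\<in>A. INF j\<in>B. d i j)"

definition gen_sigma :: "'w measure \<Rightarrow> ('i \<Rightarrow> 'w \<Rightarrow> 'b::topological_space) \<Rightarrow> 'i set \<Rightarrow> 'w set set" where
  "gen_sigma M X J = sigma_sets (space M) (\<Union>i\<in>J. {X i -` B \<inter> space M | B. B \<in> sets borel})"

definition finite_partition :: "'w measure \<Rightarrow> 'w set set \<Rightarrow> 'w set set \<Rightarrow> bool" where
  "finite_partition M F P \<longleftrightarrow> finite P \<and> P \<subseteq> F \<and> disjoint P \<and> \<Union>P = space M"

definition beta_coef :: "'w measure \<Rightarrow> 'w set set \<Rightarrow> 'w set set \<Rightarrow> real" where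
  "beta_coef M F1 F2 =
     (SUP AB \<in> {(A, B). finite_partition M F1 A \<and> finite_partition M F2 B}.
        (1/2) * (\<Sum>a\<in>fst AB. \<Sum>b\<in>snd AB. \<bar>measure M (a \<inter> b) - measure M a * measure M b\<bar>))"

definition conn_rel :: "('a \<Rightarrow> 'a \<Rightarrow> ereal) \<Rightarrow> real \<Rightarrow> 'a list \<Rightarrow> (nat \<times> nat) set" where
  "conn_rel d m xs = {(a, b). a < length xs \<and> b < length xs \<and> d (xs ! a) (xs ! b) \<le> ereal m}"

definition conn_classes :: "('a \<Rightarrow> 'a \<Rightarrow> ereal) \<Rightarrow> real \<Rightarrow> 'a list \<Rightarrow> nat set set" where
  "conn_classes d m xs =
     (\<lambda>a. {b. b < length xs \<and> (a, b) \<in> (conn_rel d m xs)\<^sup>*}) ` {..<length xs}"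

text \<open>The m-profile, represented as the multiset of class sizes (equivalently, the
  decreasingly ordered vector of class sizes).\<close>
definition profile :: "('a \<Rightarrow> 'a \<Rightarrow> ereal) \<Rightarrow> real \<Rightarrow> 'a list \<Rightarrow> nat multiset" where
  "profile d m xs = image_mset card (mset_set (conn_classes d m xs))"

definition tau :: "'a set \<Rightarrow> ('a \<Rightarrow> 'a \<Rightarrow> ereal) \<Rightarrow> real \<Rightarrow> nat list \<Rightarrow> nat" where
  "tau I d m qs = card {xs. length xs = sum_list qs \<and> set xs \<subseteq> I \<and> profile d m xs = mset qs}"

definition joint_moment :: "'w measure \<Rightarrow> ('w \<Rightarrow> 'b) \<Rightarrow> ('w \<Rightarrow> 'b) \<Rightarrow> ('b \<Rightarrow> 'b \<Rightarrow> real) \<Rightarrow> real \<Rightarrow> ennreal" where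
  "joint_moment M Xi Xj H p = (\<integral>\<^sup>+ \<omega>. ennreal (\<bar>H (Xi \<omega>) (Xj \<omega>)\<bar> powr p) \<partial>M)"

text \<open>E |H(X_i, tilde X_j)|^p, with tilde X_j an independent copy of X_j:
  integral against the product of the two marginal laws.\<close>
definition tilde_moment :: "'w measure \<Rightarrow> ('w \<Rightarrow> 'b::topological_space) \<Rightarrow> ('w \<Rightarrow> 'b) \<Rightarrow> ('b \<Rightarrow> 'b \<Rightarrow> real) \<Rightarrow> real \<Rightarrow> ennreal" where
  "tilde_moment M Xi Xj H p =
     (\<integral>\<^sup>+ z. ennreal (\<bar>H (fst z) (snd z)\<bar> powr p) \<partial>(distr M borel Xi \<Otimes>\<^sub>M distr M borel Xj))"

definition enn_rpow :: "ennreal \<Rightarrow> real \<Rightarrow> ennreal" where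
  "enn_rpow x r = (if x = \<infinity> then \<infinity> else ennreal (enn2real x powr r))"

definition Hnorm :: "'w measure \<Rightarrow> 'i set \<Rightarrow> ('i \<Rightarrow> 'w \<Rightarrow> 'b::topological_space) \<Rightarrow> ('b \<Rightarrow> 'b \<Rightarrow> real) \<Rightarrow> real \<Rightarrow> ennreal" where
  "Hnorm M I X H p =
     (SUP ij \<in> {(i, j). i \<in> I \<and> j \<in> I \<and> i \<noteq> j}.
        max (enn_rpow (joint_moment M (X (fst ij)) (X (snd ij)) H p) (1/p))
            (enn_rpow (tilde_moment M (X (fst ij)) (X (snd ij)) H p) (1/p)))"

definition sigma2 :: "'w measure \<Rightarrow> 'i set \<Rightarrow> ('i \<Rightarrow> 'w \<Rightarrow> 'b::topological_space) \<Rightarrow> ('b \<Rightarrow> 'b \<Rightarrow> real) \<Rightarrow> real" where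
  "sigma2 M I X H =
     (\<Sum>ik \<in> {(i, k). i \<in> I \<and> k \<in> I \<and> i \<noteq> k}.
        \<integral> z. (H (fst z) (snd z))\<^sup>2 \<partial>(distr M borel (X (fst ik)) \<Otimes>\<^sub>M distr M borel (X (snd ik))))"

definition Ustat :: "'i set \<Rightarrow> ('i \<Rightarrow> 'w \<Rightarrow> 'b) \<Rightarrow> ('b \<Rightarrow> 'b \<Rightarrow> real) \<Rightarrow> 'w \<Rightarrow> real" where
  "Ustat I X H \<omega> = (\<Sum>ik \<in> {(i, k). i \<in> I \<and> k \<in> I \<and> i \<noteq> k}. H (X (fst ik) \<omega>) (X (snd ik) \<omega>))"

definition Gamma :: "'w measure \<Rightarrow> ('w \<Rightarrow> 'b) \<Rightarrow> ('w \<Rightarrow> 'b) \<Rightarrow> ('b \<Rightarrow> 'b \<Rightarrow> real) \<Rightarrow> 'b \<Rightarrow> 'b \<Rightarrow> real" where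
  "Gamma M Xi Xj H x y = (\<integral> \<omega>. H (Xi \<omega>) x * H (Xj \<omega>) y \<partial>M)"

definition gamma_m1 :: "'w measure \<Rightarrow> 'i set \<Rightarrow> ('i \<Rightarrow> 'i \<Rightarrow> ereal) \<Rightarrow> ('i \<Rightarrow> 'w \<Rightarrow> 'b) \<Rightarrow> ('b \<Rightarrow> 'b \<Rightarrow> real) \<Rightarrow> real \<Rightarrow> ennreal" where
  "gamma_m1 M I d X H m =
     (SUP t \<in> {(i, j, k1, k2). i \<in> I \<and> j \<in> I \<and> k1 \<in> I \<and> k2 \<in> I \<and> d i j \<le> ereal m \<and> k1 \<noteq> k2}.
        (case t of (i, j, k1, k2) \<Rightarrow>
           ennreal \<bar>\<integral> \<omega>. Gamma M (X i) (X j) H (X k1 \<omega>) (X k2 \<omega>) \<partial>M\<bar>))"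

definition law_support :: "'w measure \<Rightarrow> ('w \<Rightarrow> 'b::topological_space) \<Rightarrow> 'b set" where
  "law_support M Y = {x. \<forall>U. open U \<and> x \<in> U \<longrightarrow> 0 < measure M (Y -` U \<inter> space M)}"

definition degenerate :: "'w measure \<Rightarrow> 'i set \<Rightarrow> ('i \<Rightarrow> 'w \<Rightarrow> 'b::topological_space) \<Rightarrow> ('b \<Rightarrow> 'b \<Rightarrow> real) \<Rightarrow> bool" where
  "degenerate M I X H \<longleftrightarrow>
     (\<forall>k\<in>I. \<forall>x \<in> (\<Union>j\<in>I. law_support M (X j)).
        integrable M (\<lambda>\<omega>. H (X k \<omega>) x) \<and> (\<integral> \<omega>. H (X k \<omega>) x \<partial>M) = 0)"

end

theory Submission
  imports Defs
begin

text \<open>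
  Expand the variance into covariances of \<open>H(X_i, X_k)\<close> and \<open>H(X_j, X_l)\<close> over quadruples
  \<open>(i, k, j, l)\<close> and sort the quadruples by their profile. The beta-mixing coefficient of two
  sigma-algebras dominates the total variation distance between the joint law and the product of
  the marginals, so by truncation a separated group of indices may be replaced by an independent
  copy at the cost of a multiple of \<open>err\<close>, i.e. \<open>H_{2+delta}^2 beta^{delta/(2+delta)}\<close>. If some
  index forms a class of its own, the decoupled expectation vanishes by degeneracy. For the classes
  \<open>{i, k}\<close> and \<open>{j, l}\<close> decoupling gives the product of the means, which the covariance subtracts;
  for \<open>{i, j}\<close> and \<open>{k, l}\<close> it gives \<open>E Gamma\<close>, which is at most \<open>gamma\<close> unless \<open>i = j\<close>
  and \<open>k = l\<close>, and these quadruples, together with those where \<open>i = l\<close> and \<open>k = j\<close>, add up to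
  \<open>2 sigma^2\<close>.
\<close>

section \<open>Comparing integrals under two close probability measures\<close>

text \<open>The norms and suprema of the hypothesis live in [0, infinity], so the error estimates
  are made there. Square integrability of H(X_i, X_k) is assumed only for independent copies; for
  the joint law it has to be extracted from the finiteness of the hypothesis before covariances make
  sense, and this is why there are two locales. A further obstacle is that \<open>m\<close> may be
  negative. Then an index counts as separated even from its own repetition, the diagonal quadruples
  have singleton classes, and \<open>h\<close> itself has to be shown small. Each use of mixing
  splits the indices into just two groups, of sizes at most 1 and 3 or 2 and 2: with three or four
  classes it is enough to free one singleton. The main term is subtracted from each covariance at
  once, in \<open>G\<close>, in a form that keeps the symmetries of the quadruple, so few positions
  have to be treated. The constant 32 is 8 + 8 + 16, for the mixed moment, the product of means and
  the diagonal term. Each 8 is 4 from truncation times 2 from the factor 1/2 in the definition of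
  beta.\<close>

lemma integral_diff_le_of_bounded:
  fixes g :: "'z \<Rightarrow> real"
  assumes P: "prob_space P" and Q: "prob_space Q" and sets: "sets Q = sets P"
    and b: "\<And>E. E \<in> sets P \<Longrightarrow> \<bar>measure P E - measure Q E\<bar> \<le> b"
    and g: "g \<in> borel_measurable P"
    and g0: "\<And>x. x \<in> space P \<Longrightarrow> 0 \<le> g x" and gT: "\<And>x. x \<in> space P \<Longrightarrow> g x \<le> T" and T: "0 < T"
  shows "\<bar>(\<integral>x. g x \<partial>P) - (\<integral>x. g x \<partial>Q)\<bar> \<le> T * b"
proof -
  interpret P: prob_space P by fact
  interpret Q: prob_space Q by fact
  have sp: "space Q = space P" using sets by (rule sets_eq_imp_space_eq)
  have gQ: "g \<in> borel_measurable Q" using g sets by (simp cong: measurable_cong_sets)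
  have iP: "integrable P g"
    by (rule P.integrable_const_bound[where B=T]) (use g g0 gT in auto)
  have iQ: "integrable Q g"
    by (rule Q.integrable_const_bound[where B=T]) (use gQ g0 gT sp in auto)
  define E where "E N k = {x \<in> space P. real k * T / real N \<le> g x}" for N k :: nat
  have E[measurable]: "E N k \<in> sets P" for N k using g unfolding E_def by measurable
  \<comment> \<open>the step function \<open>s N\<close> rounds \<open>g\<close> down to a multiple of \<open>T / N\<close>\<close>
  define s where "s N x = (\<Sum>k=1..N. T / real N * indicator (E N k) x)" for N x
  have s_close: "\<bar>g x - s N x\<bar> \<le> T / real N" if x: "x \<in> space P" and N: "N > 0" for N x
  proof -
    define K where "K = nat \<lfloor>g x * real N / T\<rfloor>"
    have nn: "0 \<le> g x * real N / T" using g0[OF x] T by auto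
    have K1: "real K \<le> g x * real N / T" "g x * real N / T < real K + 1"
      unfolding K_def using nn by linarith+
    have "g x * real N / T \<le> real N" using gT[OF x] T N
      by (simp add: field_simps)
    then have KN: "K \<le> N" using K1 by linarith
    have "(real k * T / real N \<le> g x) = (k \<le> K)" for k :: nat
    proof -
      have "(real k * T / real N \<le> g x) = (real k \<le> g x * real N / T)"
        using T N by (simp add: field_simps)
      also have "\<dots> = (k \<le> K)" using K1 by linarith
      finally show ?thesis .
    qed
    then have "s N x = (\<Sum>k=1..N. if k \<le> K then T / real N else 0)"
      unfolding s_def E_def using x by (intro sum.cong) auto
    also have "\<dots> = (\<Sum>k\<in>{1..K}. T / real N)"
      by (rule sum.mono_neutral_cong_right) (use KN in auto)
    finally have "s N x = real K * (T / real N)" by simp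
    moreover have "g x = g x * real N / T * (T / real N)" using T N by simp
    ultimately have "g x - s N x = (g x * real N / T - real K) * (T / real N)"
      by (simp add: algebra_simps)
    moreover have "(g x * real N / T - real K) * (T / real N) \<le> 1 * (T / real N)"
      by (rule mult_right_mono) (use K1 T N in auto)
    moreover have "0 \<le> (g x * real N / T - real K) * (T / real N)"
      using K1 T N by (intro mult_nonneg_nonneg) auto
    ultimately show ?thesis by simp
  qed
  have s_int: "\<bar>(\<integral>x. s N x \<partial>P) - (\<integral>x. s N x \<partial>Q)\<bar> \<le> T * b" if N: "N > 0" for N
  proof -
    have "(\<integral>x. s N x \<partial>P) = (\<Sum>k=1..N. T / real N * measure P (E N k))"
      unfolding s_def by (subst Bochner_Integration.integral_sum) (auto simp: less_top[symmetric])
    moreover have "(\<integral>x. s N x \<partial>Q) = (\<Sum>k=1..N. T / real N * measure Q (E N k))"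
      unfolding s_def
      by (subst Bochner_Integration.integral_sum) (auto simp: less_top[symmetric] sets)
    ultimately have "\<bar>(\<integral>x. s N x \<partial>P) - (\<integral>x. s N x \<partial>Q)\<bar>
        = \<bar>\<Sum>k=1..N. T / real N * (measure P (E N k) - measure Q (E N k))\<bar>"
      by (simp add: sum_subtractf right_diff_distrib)
    also have "\<dots> \<le> (\<Sum>k=1..N. T / real N * b)"
      by (rule order_trans[OF sum_abs], rule sum_mono)
         (use T N b[OF E] in \<open>simp add: abs_mult divide_right_mono mult_left_mono\<close>)
    finally show ?thesis using N by simp
  qed
  have si: "integrable P (s N)" "integrable Q (s N)" for N
    unfolding s_def by (auto simp: less_top[symmetric] sets)
  \<comment> \<open>Rounding costs \<open>T / N\<close> under each of the two measures; this
    disappears as \<open>N\<close> tends to infinity.\<close>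
  have key: "\<bar>(\<integral>x. g x \<partial>P) - (\<integral>x. g x \<partial>Q)\<bar> \<le> T * b + 2 * T / real N" if N: "N > 0" for N
  proof -
    have "\<bar>(\<integral>x. g x \<partial>P) - (\<integral>x. s N x \<partial>P)\<bar> \<le> (\<integral>x. \<bar>g x - s N x\<bar> \<partial>P)"
      using integral_abs_bound[of P "\<lambda>x. g x - s N x"] iP si(1)[of N] by simp
    also have "\<dots> \<le> (\<integral>x. T / real N \<partial>P)"
      by (rule integral_mono) (use iP si s_close N in auto)
    finally have 1: "\<bar>(\<integral>x. g x \<partial>P) - (\<integral>x. s N x \<partial>P)\<bar> \<le> T / real N" by (simp add: P.prob_space)
    have "\<bar>(\<integral>x. g x \<partial>Q) - (\<integral>x. s N x \<partial>Q)\<bar> \<le> (\<integral>x. \<bar>g x - s N x\<bar> \<partial>Q)"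
      using integral_abs_bound[of Q "\<lambda>x. g x - s N x"] iQ si(2)[of N] by simp
    also have "\<dots> \<le> (\<integral>x. T / real N \<partial>Q)"
      by (rule integral_mono) (use iQ si s_close N sp in auto)
    finally have 2: "\<bar>(\<integral>x. g x \<partial>Q) - (\<integral>x. s N x \<partial>Q)\<bar> \<le> T / real N" by (simp add: Q.prob_space)
    show ?thesis using 1 2 s_int[OF N] by (simp add: abs_le_iff)
  qed
  have "(\<lambda>N. T * b + 2 * T / real N) \<longlonglongrightarrow> T * b + 0"
    by (intro tendsto_intros lim_const_over_n)
  then show ?thesis
    by (intro LIMSEQ_le_const[of _ "T * b"]) (use key in \<open>auto intro!: exI[of _ 1]\<close>)
qed

text \<open>Cutting \<open>f\<close> at height \<open>T\<close> leaves a bounded part and one tail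
  under each measure, the tails being controlled by the moment as in Markov's inequality. The
  constant is 4 = 2 + 1 + 1: the bounded part ranges over an interval of length 2T, and each tail
  costs another K b^(1 - 1/p).\<close>

lemma integral_diff_le_of_moment:
  fixes f :: "'z \<Rightarrow> real"
  assumes P: "prob_space P" and Q: "prob_space Q" and sets: "sets Q = sets P"
    and b: "\<And>E. E \<in> sets P \<Longrightarrow> \<bar>measure P E - measure Q E\<bar> \<le> b" and b0: "0 < b"
    and iP: "integrable P f" and iQ: "integrable Q f"
    and p: "1 < p" and K: "0 < K"
    and mP: "(\<integral>\<^sup>+x. ennreal (\<bar>f x\<bar> powr p) \<partial>P) \<le> ennreal (K powr p)"
    and mQ: "(\<integral>\<^sup>+x. ennreal (\<bar>f x\<bar> powr p) \<partial>Q) \<le> ennreal (K powr p)"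
  shows "\<bar>(\<integral>x. f x \<partial>P) - (\<integral>x. f x \<partial>Q)\<bar> \<le> 4 * K * b powr (1 - 1 / p)"
proof -
  \<comment> \<open>truncation level balancing the bulk error \<open>T b\<close> against the tail error \<open>K^p T^(1 - p)\<close>\<close>
  define T where "T = K * b powr (- 1 / p)"
  have T: "0 < T" unfolding T_def using K b0 by simp
  define h where "h x = max (- T) (min T (f x))" for x
  have tail: "\<bar>f x - h x\<bar> \<le> \<bar>f x\<bar> powr p * T powr (1 - p)" for x
  proof (cases "\<bar>f x\<bar> \<le> T")
    case True
    then show ?thesis unfolding h_def by (auto simp: abs_le_iff)
  next
    case False
    then have "\<bar>f x\<bar> powr (1 - p) \<le> T powr (1 - p)" using p T
      by (intro powr_mono2') auto
    then have "\<bar>f x\<bar> powr p * \<bar>f x\<bar> powr (1 - p) \<le> \<bar>f x\<bar> powr p * T powr (1 - p)"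
      by (intro mult_left_mono) auto
    moreover have "\<bar>f x\<bar> powr p * \<bar>f x\<bar> powr (1 - p) = \<bar>f x\<bar>"
      using False T by (simp flip: powr_add)
    moreover have "\<bar>f x - h x\<bar> \<le> \<bar>f x\<bar>" using T unfolding h_def by auto
    ultimately show ?thesis by linarith
  qed
  have tail_int: "\<bar>(\<integral>x. f x \<partial>R) - (\<integral>x. h x \<partial>R)\<bar> \<le> K powr p * T powr (1 - p)"
      and h_int: "integrable R h"
    if R: "prob_space R" and i: "integrable R f"
      and m: "(\<integral>\<^sup>+x. ennreal (\<bar>f x\<bar> powr p) \<partial>R) \<le> ennreal (K powr p)" for R
  proof -
    interpret R: prob_space R by fact
    have [measurable]: "f \<in> borel_measurable R" using i by auto
    have [measurable]: "h \<in> borel_measurable R" unfolding h_def by measurable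
    show ih: "integrable R h"
      by (rule R.integrable_const_bound[where B=T]) (use T in \<open>auto simp: h_def abs_le_iff\<close>)
    have ip: "integrable R (\<lambda>x. \<bar>f x\<bar> powr p)"
      using m by (intro integrableI_nonneg) (auto intro: order.strict_trans1)
    have "ennreal (\<integral>x. \<bar>f x\<bar> powr p \<partial>R) \<le> ennreal (K powr p)"
      using m ip by (subst nn_integral_eq_integral[symmetric]) auto
    then have le: "(\<integral>x. \<bar>f x\<bar> powr p \<partial>R) \<le> K powr p" by (simp add: ennreal_le_iff)
    have "\<bar>(\<integral>x. f x \<partial>R) - (\<integral>x. h x \<partial>R)\<bar> \<le> (\<integral>x. \<bar>f x - h x\<bar> \<partial>R)"
      using integral_abs_bound[of R "\<lambda>x. f x - h x"] i ih by simp
    also have "\<dots> \<le> (\<integral>x. \<bar>f x\<bar> powr p * T powr (1 - p) \<partial>R)"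
      by (rule integral_mono) (use i ih ip tail in auto)
    also have "\<dots> \<le> K powr p * T powr (1 - p)" using le by (simp add: mult_right_mono)
    finally show "\<bar>(\<integral>x. f x \<partial>R) - (\<integral>x. h x \<partial>R)\<bar> \<le> K powr p * T powr (1 - p)" .
  qed
  interpret P: prob_space P by fact
  interpret Q: prob_space Q by fact
  have hP: "integrable P h" and hQ: "integrable Q h"
    using h_int[OF P iP mP] h_int[OF Q iQ mQ] .
  \<comment> \<open>Adding \<open>T\<close> moves the values of \<open>h\<close> from [-T, T] into
    [0, 2T], the form required by the comparison of bounded functions.\<close>
  have "\<bar>(\<integral>x. h x + T \<partial>P) - (\<integral>x. h x + T \<partial>Q)\<bar> \<le> (2 * T) * b"
    by (rule integral_diff_le_of_bounded[OF P Q sets b])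
       (use hP T in \<open>auto simp: h_def[abs_def] intro!: borel_measurable_add\<close>)
  then have "\<bar>(\<integral>x. h x \<partial>P) - (\<integral>x. h x \<partial>Q)\<bar> \<le> (2 * T) * b"
    using hP hQ by (simp add: P.prob_space Q.prob_space)
  moreover have "T * b = K * b powr (1 - 1 / p)"
    unfolding T_def using b0 by (simp add: powr_diff powr_minus field_simps)
  moreover have "K powr p * T powr (1 - p) = K * b powr (1 - 1 / p)"
  proof -
    have "T powr (1 - p) = K powr (1 - p) * b powr (- 1 / p * (1 - p))"
      unfolding T_def using K b0 by (simp add: powr_mult powr_powr)
    also have "- 1 / p * (1 - p) = 1 - 1 / p" using p by (simp add: field_simps)
    finally have "K powr p * T powr (1 - p) = (K powr p * K powr (1 - p)) * b powr (1 - 1 / p)"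
      by simp
    also have "K powr p * K powr (1 - p) = K" using K by (simp flip: powr_add)
    finally show ?thesis .
  qed
  ultimately show ?thesis
    using tail_int[OF P iP mP] tail_int[OF Q iQ mQ] by linarith
qed

section \<open>Comparing the expectation of a product of two functions in L^(2+delta)\<close>

definition Lnorm :: "'z measure \<Rightarrow> ('z \<Rightarrow> real) \<Rightarrow> real \<Rightarrow> ennreal" where
  "Lnorm R f p = enn_rpow (\<integral>\<^sup>+x. ennreal (\<bar>f x\<bar> powr p) \<partial>R) (1 / p)"

lemma nn_integral_le_of_Lnorm:
  assumes "Lnorm R f p \<le> ennreal K" "0 \<le> K" "0 < p"
  shows "(\<integral>\<^sup>+x. ennreal (\<bar>f x\<bar> powr p) \<partial>R) \<le> ennreal (K powr p)"
proof -
  define e where "e = (\<integral>\<^sup>+x. ennreal (\<bar>f x\<bar> powr p) \<partial>R)"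
  have fin: "e \<noteq> \<infinity>" and le: "ennreal (enn2real e powr (1 / p)) \<le> ennreal K"
    using assms(1) unfolding Lnorm_def enn_rpow_def e_def by (auto split: if_splits simp: top_unique)
  then have "enn2real e powr (1 / p) \<le> K" using assms by (simp add: ennreal_le_iff)
  then have "(enn2real e powr (1 / p)) powr p \<le> K powr p" using assms by (intro powr_mono2) auto
  then have "enn2real e \<le> K powr p" using assms by (simp add: powr_powr)
  then show ?thesis using fin unfolding e_def[symmetric]
    by (metis ennreal_enn2real ennreal_leI infinity_ennreal_def less_top)
qed

lemma prob_measure_eqI:
  assumes "prob_space P" "prob_space Q" "sets Q = sets P"
    and "\<And>E. E \<in> sets P \<Longrightarrow> measure P E = measure Q E"
  shows "P = Q"
proof -
  interpret P: prob_space P by fact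
  interpret Q: prob_space Q by fact
  show ?thesis using assms
    by (intro measure_eqI) (auto simp: P.emeasure_eq_measure Q.emeasure_eq_measure)
qed

text \<open>Two cases fall outside the truncation argument: for b = 0 the two measures coincide, and
  for b > 0 with infinite \<open>N\<close> the right side is infinite.\<close>

lemma integral_mult_diff_le_Lnorm:
  fixes u v :: "'z \<Rightarrow> real"
  assumes P: "prob_space P" and Q: "prob_space Q" and sets: "sets Q = sets P"
    and b: "\<And>E. E \<in> sets P \<Longrightarrow> \<bar>measure P E - measure Q E\<bar> \<le> b" and b0: "0 \<le> b"
    and u: "u \<in> borel_measurable P" and v: "v \<in> borel_measurable P"
    and iP: "integrable P (\<lambda>x. u x * v x)" and iQ: "integrable Q (\<lambda>x. u x * v x)"
    and \<delta>: "0 < \<delta>"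
    and uP: "Lnorm P u (2 + \<delta>) \<le> N" and vP: "Lnorm P v (2 + \<delta>) \<le> N"
    and uQ: "Lnorm Q u (2 + \<delta>) \<le> N" and vQ: "Lnorm Q v (2 + \<delta>) \<le> N"
  shows "ennreal \<bar>(\<integral>x. u x * v x \<partial>P) - (\<integral>x. u x * v x \<partial>Q)\<bar>
    \<le> 4 * N\<^sup>2 * ennreal (b powr (\<delta> / (2 + \<delta>)))"
proof (cases "b = 0")
  case True
  then have "P = Q" using b by (intro prob_measure_eqI[OF P Q sets]) force
  then show ?thesis by simp
next
  case False
  with b0 have bpos: "0 < b" by simp
  show ?thesis
  proof (cases "N = \<infinity>")
    case True
    with bpos show ?thesis by (simp add: ennreal_mult_top ennreal_top_mult power2_eq_square)
  next
    case False
    define c where "c = enn2real N"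
    have N: "N = ennreal c" and c0: "0 \<le> c" using False by (auto simp: c_def less_top)
    \<comment> \<open>A product of two functions in L^(2+delta) lies in L^p for half that exponent,
      and 1 - 1/p is then the exponent of \<open>b\<close> in the claim.\<close>
    define p where "p = (2 + \<delta>) / 2"
    have p: "1 < p" using \<delta> by (simp add: p_def)
    have pr: "1 - 1 / p = \<delta> / (2 + \<delta>)" using \<delta> by (simp add: p_def field_simps)
    have young: "(\<integral>\<^sup>+x. ennreal (\<bar>u x * v x\<bar> powr p) \<partial>R) \<le> ennreal ((K\<^sup>2) powr p)"
      if R: "Lnorm R u (2 + \<delta>) \<le> N" "Lnorm R v (2 + \<delta>) \<le> N" "sets R = sets P" and K: "c < K" for R K
    proof -
      have [measurable]: "u \<in> borel_measurable R" "v \<in> borel_measurable R"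
        using u v R(3) by (auto cong: measurable_cong_sets)
      \<comment> \<open>The arithmetic-geometric mean inequality stands in for Cauchy-Schwarz.
        Nothing is lost, as both factors have the same norm bound.\<close>
      have pp: "\<bar>a * b\<bar> powr p \<le> (1/2) * (\<bar>a\<bar> powr (2 + \<delta>) + \<bar>b\<bar> powr (2 + \<delta>))" for a b :: real
      proof -
        have "2 * (\<bar>a\<bar> powr p * \<bar>b\<bar> powr p) \<le> (\<bar>a\<bar> powr p)\<^sup>2 + (\<bar>b\<bar> powr p)\<^sup>2"
          using sum_squares_bound[of "\<bar>a\<bar> powr p" "\<bar>b\<bar> powr p"] by simp
        moreover have "(\<bar>x\<bar> powr p)\<^sup>2 = \<bar>x\<bar> powr (2 + \<delta>)" for x :: real
          by (simp add: power2_eq_square p_def flip: powr_add)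
        ultimately show ?thesis by (simp add: abs_mult powr_mult)
      qed
      have "ennreal (\<bar>a * b\<bar> powr p)
          \<le> ennreal (1/2) * (ennreal (\<bar>a\<bar> powr (2 + \<delta>)) + ennreal (\<bar>b\<bar> powr (2 + \<delta>)))" for a b
        using pp[of a b]
        by (subst ennreal_plus[symmetric], simp, simp, subst ennreal_mult[symmetric]) (auto intro: ennreal_leI)
      then have "(\<integral>\<^sup>+x. ennreal (\<bar>u x * v x\<bar> powr p) \<partial>R)
          \<le> (\<integral>\<^sup>+x. ennreal (1/2) * (ennreal (\<bar>u x\<bar> powr (2 + \<delta>)) + ennreal (\<bar>v x\<bar> powr (2 + \<delta>))) \<partial>R)"
        by (intro nn_integral_mono) auto
      also have "\<dots> = ennreal (1/2) * ((\<integral>\<^sup>+x. ennreal (\<bar>u x\<bar> powr (2 + \<delta>)) \<partial>R) + (\<integral>\<^sup>+x. ennreal (\<bar>v x\<bar> powr (2 + \<delta>)) \<partial>R))"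
        by (subst nn_integral_cmult, simp, subst nn_integral_add) auto
      also have "\<dots> \<le> ennreal (1/2) * (ennreal (K powr (2 + \<delta>)) + ennreal (K powr (2 + \<delta>)))"
        using R K c0 \<delta> unfolding N
        by (intro mult_left_mono add_mono nn_integral_le_of_Lnorm) (auto elim: order_trans)
      also have "\<dots> = ennreal (1/2 * (K powr (2 + \<delta>) + K powr (2 + \<delta>)))"
        by (subst ennreal_mult, simp, simp, subst ennreal_plus) auto
      also have "\<dots> = ennreal (K powr (2 + \<delta>))" by simp
      also have "K powr (2 + \<delta>) = (K\<^sup>2) powr p"
        using K c0 by (simp add: p_def power2_eq_square powr_mult flip: powr_add)
      finally show ?thesis .
    qed
    have main: "\<bar>(\<integral>x. u x * v x \<partial>P) - (\<integral>x. u x * v x \<partial>Q)\<bar> \<le> 4 * K\<^sup>2 * b powr (\<delta> / (2 + \<delta>))"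
      if K: "c < K" for K
      using integral_diff_le_of_moment[OF P Q sets b bpos iP iQ p, of "K\<^sup>2",
          OF _ _ young[OF uP vP _ K] young[OF uQ vQ sets K]] K c0
      by (simp add: pr)
    \<comment> \<open>The moment comparison asks for a positive bound and \<open>c\<close> may be 0,
      so it is applied with K > c and K then decreases to \<open>c\<close>.\<close>
    have "(\<lambda>n. 4 * (c + inverse (real (Suc n)))\<^sup>2 * b powr (\<delta> / (2 + \<delta>)))
        \<longlonglongrightarrow> 4 * (c + 0)\<^sup>2 * b powr (\<delta> / (2 + \<delta>))"
      by (intro tendsto_intros LIMSEQ_inverse_real_of_nat)
    then have "\<bar>(\<integral>x. u x * v x \<partial>P) - (\<integral>x. u x * v x \<partial>Q)\<bar> \<le> 4 * c\<^sup>2 * b powr (\<delta> / (2 + \<delta>))"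
      by (intro LIMSEQ_le_const[of _ "4 * c\<^sup>2 * b powr (\<delta> / (2 + \<delta>))"]) (auto intro!: main)
    then have "ennreal \<bar>(\<integral>x. u x * v x \<partial>P) - (\<integral>x. u x * v x \<partial>Q)\<bar> \<le> ennreal (4 * c\<^sup>2 * b powr (\<delta> / (2 + \<delta>)))"
      by (rule ennreal_leI)
    also have "\<dots> = 4 * N\<^sup>2 * ennreal (b powr (\<delta> / (2 + \<delta>)))"
      unfolding N using c0 by (simp add: ennreal_mult' ennreal_power flip: ennreal_numeral)
    finally show ?thesis .
  qed
qed

section \<open>Total variation distance and the beta-mixing coefficient\<close>

text \<open>The sets that can be approximated to every accuracy contain the generators and are
  closed under complements and countable unions. One \<open>F\<close> must serve both measures,
  because the measures will be compared on that same \<open>F\<close>.\<close>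

lemma sigma_sets_approx_by_algebra:
  assumes P: "finite_measure P" and Q: "finite_measure Q" and sets: "sets Q = sets P"
    and gen: "sets P = sigma_sets (space P) G"
    and G: "G \<subseteq> \<A>" and A: "\<A> \<subseteq> sets P"
    and compl: "\<And>F. F \<in> \<A> \<Longrightarrow> space P - F \<in> \<A>"
    and empty: "{} \<in> \<A>" and un: "\<And>F F'. F \<in> \<A> \<Longrightarrow> F' \<in> \<A> \<Longrightarrow> F \<union> F' \<in> \<A>"
    and E: "E \<in> sets P" and e: "0 < e"
  shows "\<exists>F\<in>\<A>. measure P ((E - F) \<union> (F - E)) < e \<and> measure Q ((E - F) \<union> (F - E)) < e"
proof -
  interpret P: finite_measure P by fact
  interpret Q: finite_measure Q by fact
  have "E \<in> sigma_sets (space P) G" using E gen by simp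
  then have "\<forall>e>0. \<exists>F\<in>\<A>. measure P ((E - F) \<union> (F - E)) < e \<and> measure Q ((E - F) \<union> (F - E)) < e"
  proof induction
    case (Basic a)
    then show ?case using G by (intro allI impI bexI[of _ a]) auto
  next
    case Empty
    then show ?case using empty by (intro allI impI bexI[of _ "{}"]) auto
  next
    case (Compl a)
    show ?case
    proof (intro allI impI)
      fix e :: real assume "0 < e"
      then obtain F where F: "F \<in> \<A>" "measure P ((a - F) \<union> (F - a)) < e" "measure Q ((a - F) \<union> (F - a)) < e"
        using Compl by blast
      have "F \<subseteq> space P" using F A sets.sets_into_space by blast
      moreover have "a \<subseteq> space P" using Compl(1) sets.sets_into_space[of a P] gen by auto
      ultimately have "((space P - a) - (space P - F)) \<union> ((space P - F) - (space P - a)) = (a - F) \<union> (F - a)"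
        by blast
      then show "\<exists>F\<in>\<A>. measure P (space P - a - F \<union> (F - (space P - a))) < e \<and>
             measure Q (space P - a - F \<union> (F - (space P - a))) < e"
        using F compl by (intro bexI[of _ "space P - F"]) auto
    qed
  next
    case (Union a)
    have a: "a i \<in> sets P" for i using Union(1) gen by simp
    show ?case
    proof (intro allI impI)
      fix e :: real assume e: "0 < e"
      have lim: "\<exists>N0. \<forall>N\<ge>N0. measure R ((\<Union>i. a i) - (\<Union>i<N. a i)) < e / 2"
        if R: "finite_measure R" "sets R = sets P" for R
      proof -
        interpret R: finite_measure R by fact
        have "(\<lambda>N. measure R (\<Union>i<N. a i)) \<longlonglongrightarrow> measure R (\<Union>N. \<Union>i<N. a i)"
          by (rule R.finite_Lim_measure_incseq) (use a R in \<open>auto simp: incseq_def intro: less_le_trans\<close>)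
        also have "(\<Union>N. \<Union>i<N. a i) = (\<Union>i. a i)" by auto
        finally have "\<forall>\<^sub>F N in sequentially. dist (measure R (\<Union>i<N. a i)) (measure R (\<Union>i. a i)) < e / 2"
          using e by (auto dest!: tendstoD[where e="e/2"])
        then obtain N0 where N0: "\<And>N. N \<ge> N0 \<Longrightarrow> dist (measure R (\<Union>i<N. a i)) (measure R (\<Union>i. a i)) < e / 2"
          unfolding eventually_sequentially by blast
        have "measure R ((\<Union>i. a i) - (\<Union>i<N. a i)) = measure R (\<Union>i. a i) - measure R (\<Union>i<N. a i)" for N
          by (rule R.finite_measure_Diff) (use a R in auto)
        then show ?thesis using N0 unfolding dist_real_def by (intro exI[of _ N0]) (smt (verit))
      qed
      obtain N1 N2 where N1: "\<forall>N\<ge>N1. measure P ((\<Union>i. a i) - (\<Union>i<N. a i)) < e / 2"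
        and N2: "\<forall>N\<ge>N2. measure Q ((\<Union>i. a i) - (\<Union>i<N. a i)) < e / 2"
        using lim[OF P] lim[OF Q sets] by auto
      \<comment> \<open>The successor makes \<open>N\<close> positive, so that the error e/2 can be
        shared among the first \<open>N\<close> sets.\<close>
      define N where "N = Suc (max N1 N2)"
      have N: "measure P ((\<Union>i. a i) - (\<Union>i<N. a i)) < e / 2" "measure Q ((\<Union>i. a i) - (\<Union>i<N. a i)) < e / 2"
        using N1 N2 unfolding N_def by auto
      have Npos: "0 < real N" by (simp add: N_def)
      have "\<forall>i. \<exists>F\<in>\<A>. measure P ((a i - F) \<union> (F - a i)) < e / (2 * N) \<and> measure Q ((a i - F) \<union> (F - a i)) < e / (2 * N)"
        using Union(2) e Npos by (auto simp: zero_less_divide_iff)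
      then obtain F where F: "\<And>i. F i \<in> \<A>" "\<And>i. measure P ((a i - F i) \<union> (F i - a i)) < e / (2 * N)"
        "\<And>i. measure Q ((a i - F i) \<union> (F i - a i)) < e / (2 * N)"
        by metis
      define F' where "F' = (\<Union>i<N. F i)"
      have Fs: "F i \<in> sets P" for i using F A by blast
      have "(\<Union>i<n. F i) \<in> \<A>" for n
        by (induction n) (use empty un F in \<open>auto simp: lessThan_Suc\<close>)
      then have F'A: "F' \<in> \<A>" unfolding F'_def .
      have bound: "measure R (((\<Union>i. a i) - F') \<union> (F' - (\<Union>i. a i))) < e"
        if R: "finite_measure R" "sets R = sets P"
          and R1: "measure R ((\<Union>i. a i) - (\<Union>i<N. a i)) < e / 2"
          and R2: "\<And>i. measure R ((a i - F i) \<union> (F i - a i)) < e / (2 * N)" for R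
      proof -
        interpret R: finite_measure R by fact
        have "measure R (((\<Union>i. a i) - F') \<union> (F' - (\<Union>i. a i)))
            \<le> measure R (((\<Union>i. a i) - (\<Union>i<N. a i)) \<union> (\<Union>i<N. (a i - F i) \<union> (F i - a i)))"
          by (rule R.finite_measure_mono) (use a Fs R in \<open>auto simp: F'_def\<close>)
        also have "\<dots> \<le> measure R ((\<Union>i. a i) - (\<Union>i<N. a i)) + measure R (\<Union>i<N. (a i - F i) \<union> (F i - a i))"
          by (rule measure_Un_le) (use a Fs R in auto)
        also have "measure R (\<Union>i<N. (a i - F i) \<union> (F i - a i)) \<le> (\<Sum>i<N. measure R ((a i - F i) \<union> (F i - a i)))"
          by (rule measure_UNION_le) (use a Fs R in auto)
        also have "\<dots> \<le> (\<Sum>i<N. e / (2 * N))"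
          by (rule sum_mono) (use R2 in \<open>auto intro: less_imp_le\<close>)
        also have "\<dots> = e / 2" using Npos by simp
        finally show ?thesis using R1 by linarith
      qed
      show "\<exists>F\<in>\<A>. measure P (\<Union> (range a) - F \<union> (F - \<Union> (range a))) < e \<and>
             measure Q (\<Union> (range a) - F \<union> (F - \<Union> (range a))) < e"
        using F'A bound[OF P refl N(1) F(2)] bound[OF Q sets N(2) F(3)] by auto
    qed
  qed
  with e show ?thesis by blast
qed

text \<open>The finite unions of cells of a finite measurable product partition, the two partitions
  being the level sets of \<open>g1\<close> and \<open>g2\<close>.\<close>
definition grid_sets :: "'a measure \<Rightarrow> 'b measure \<Rightarrow> ('a \<times> 'b) set set" where
  "grid_sets F1 F2 = {F. \<exists>(g1 :: 'a \<Rightarrow> nat) (g2 :: 'b \<Rightarrow> nat) T.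
     g1 \<in> F1 \<rightarrow>\<^sub>M count_space UNIV \<and> g2 \<in> F2 \<rightarrow>\<^sub>M count_space UNIV \<and>
     finite (g1 ` space F1) \<and> finite (g2 ` space F2) \<and>
     F = {z \<in> space F1 \<times> space F2. (g1 (fst z), g2 (snd z)) \<in> T}}"

lemma grid_sets_measurable: "grid_sets F1 F2 \<subseteq> sets (F1 \<Otimes>\<^sub>M F2)"
proof
  fix F assume "F \<in> grid_sets F1 F2"
  then obtain g1 :: "'a \<Rightarrow> nat" and g2 :: "'b \<Rightarrow> nat" and T where
    g[measurable]: "g1 \<in> F1 \<rightarrow>\<^sub>M count_space UNIV" "g2 \<in> F2 \<rightarrow>\<^sub>M count_space UNIV"
    and F: "F = {z \<in> space F1 \<times> space F2. (g1 (fst z), g2 (snd z)) \<in> T}"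
    unfolding grid_sets_def by blast
  have "F = (\<Union>t\<in>T. (g1 -` {fst t} \<inter> space F1) \<times> (g2 -` {snd t} \<inter> space F2))"
    unfolding F by force
  also have "\<dots> \<in> sets (F1 \<Otimes>\<^sub>M F2)"
    by (intro sets.countable_UN' pair_measureI measurable_sets[OF g(1)] measurable_sets[OF g(2)]) auto
  finally show "F \<in> sets (F1 \<Otimes>\<^sub>M F2)" .
qed

text \<open>The indicators of the two sides give a grid of at most four cells, and the rectangle is
  the cell with code (1, 1).\<close>

lemma rectangle_in_grid_sets:
  assumes "A \<in> sets F1" "B \<in> sets F2"
  shows "A \<times> B \<in> grid_sets F1 F2"
proof -
  let ?g = "\<lambda>S x. if x \<in> S then 1 else 0 :: nat"
  have "?g A \<in> F1 \<rightarrow>\<^sub>M count_space UNIV" "?g B \<in> F2 \<rightarrow>\<^sub>M count_space UNIV"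
    using assms by (auto intro!: measurable_If_set)
  moreover have "finite (?g A ` space F1)" "finite (?g B ` space F2)"
    by (rule finite_subset[of _ "{0, 1}"], auto)+
  moreover have "A \<times> B = {z \<in> space F1 \<times> space F2. (?g A (fst z), ?g B (snd z)) \<in> {(1, 1)}}"
    using assms[THEN sets.sets_into_space] by (auto split: if_splits)
  ultimately show ?thesis unfolding grid_sets_def by blast
qed

lemma grid_sets_compl:
  assumes "F \<in> grid_sets F1 F2"
  shows "space F1 \<times> space F2 - F \<in> grid_sets F1 F2"
proof -
  obtain g1 :: "'a \<Rightarrow> nat" and g2 :: "'b \<Rightarrow> nat" and T where
    g: "g1 \<in> F1 \<rightarrow>\<^sub>M count_space UNIV" "g2 \<in> F2 \<rightarrow>\<^sub>M count_space UNIV"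
      "finite (g1 ` space F1)" "finite (g2 ` space F2)"
    and F: "F = {z \<in> space F1 \<times> space F2. (g1 (fst z), g2 (snd z)) \<in> T}"
    using assms unfolding grid_sets_def by blast
  have "space F1 \<times> space F2 - F = {z \<in> space F1 \<times> space F2. (g1 (fst z), g2 (snd z)) \<in> - T}"
    unfolding F by auto
  then show ?thesis using g unfolding grid_sets_def by blast
qed

text \<open>Both sets are unions of cells of the common refinement of the two grids. Its cells carry
  the pair of the old codes, and \<open>prod_encode\<close> turns this pair into a natural number
  again.\<close>

lemma grid_sets_Un:
  assumes "F \<in> grid_sets F1 F2" "F' \<in> grid_sets F1 F2"
  shows "F \<union> F' \<in> grid_sets F1 F2"
proof -
  obtain g1 :: "'a \<Rightarrow> nat" and g2 :: "'b \<Rightarrow> nat" and T where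
    g: "g1 \<in> F1 \<rightarrow>\<^sub>M count_space UNIV" "g2 \<in> F2 \<rightarrow>\<^sub>M count_space UNIV"
      "finite (g1 ` space F1)" "finite (g2 ` space F2)"
    and F: "F = {z \<in> space F1 \<times> space F2. (g1 (fst z), g2 (snd z)) \<in> T}"
    using assms(1) unfolding grid_sets_def by blast
  obtain h1 :: "'a \<Rightarrow> nat" and h2 :: "'b \<Rightarrow> nat" and T' where
    h: "h1 \<in> F1 \<rightarrow>\<^sub>M count_space UNIV" "h2 \<in> F2 \<rightarrow>\<^sub>M count_space UNIV"
      "finite (h1 ` space F1)" "finite (h2 ` space F2)"
    and F': "F' = {z \<in> space F1 \<times> space F2. (h1 (fst z), h2 (snd z)) \<in> T'}"
    using assms(2) unfolding grid_sets_def by blast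
  let ?k1 = "\<lambda>x. prod_encode (g1 x, h1 x)" and ?k2 = "\<lambda>x. prod_encode (g2 x, h2 x)"
  let ?T = "{(a, b). (fst (prod_decode a), fst (prod_decode b)) \<in> T \<or> (snd (prod_decode a), snd (prod_decode b)) \<in> T'}"
  note [measurable] = g(1,2) h(1,2)
  have "?k1 \<in> F1 \<rightarrow>\<^sub>M count_space UNIV" "?k2 \<in> F2 \<rightarrow>\<^sub>M count_space UNIV"
    by measurable
  moreover have "finite (?k1 ` space F1)"
    by (rule finite_subset[of _ "prod_encode ` (g1 ` space F1 \<times> h1 ` space F1)"]) (use g h in auto)
  moreover have "finite (?k2 ` space F2)"
    by (rule finite_subset[of _ "prod_encode ` (g2 ` space F2 \<times> h2 ` space F2)"]) (use g h in auto)
  moreover have "F \<union> F' = {z \<in> space F1 \<times> space F2. (?k1 (fst z), ?k2 (snd z)) \<in> ?T}"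
    unfolding F F' by auto
  ultimately show ?thesis unfolding grid_sets_def by blast
qed

lemma level_sets_finite_partition:
  fixes g :: "'w \<Rightarrow> nat"
  assumes "g \<in> F \<rightarrow>\<^sub>M count_space UNIV" "finite (g ` space F)" "space F = space M"
  shows "finite_partition M (sets F) ((\<lambda>v. g -` {v} \<inter> space F) ` g ` space F)"
proof -
  have "g -` {v} \<inter> space F \<in> sets F" for v using assms(1) by (rule measurable_sets) simp
  then show ?thesis using assms unfolding finite_partition_def disjoint_def by auto
qed

text \<open>Values taken on \<open>S\<close> have nonempty and distinct level sets, so a sum over
  values can be read as a sum over the cells of a partition.\<close>

lemma inj_on_level_sets: "inj_on (\<lambda>v. g -` {v} \<inter> S) (g ` S)"
  by (rule inj_onI) auto

text \<open>The supremum in \<open>beta_coef\<close> is a real one and dominates its members only if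
  they are bounded. The bound comes from the two total masses, each equal to 1.\<close>

lemma beta_sum_le_2:
  assumes M: "prob_space M" and F: "F1 \<subseteq> sets M" "F2 \<subseteq> sets M"
    and A: "finite_partition M F1 A" and B: "finite_partition M F2 B"
  shows "(\<Sum>a\<in>A. \<Sum>b\<in>B. \<bar>measure M (a \<inter> b) - measure M a * measure M b\<bar>) \<le> 2"
proof -
  interpret M: prob_space M by fact
  have fin: "finite A" "finite B" and ms: "\<And>a. a \<in> A \<Longrightarrow> a \<in> sets M" "\<And>b. b \<in> B \<Longrightarrow> b \<in> sets M"
    and un: "\<Union>A = space M" "\<Union>B = space M"
    and dj: "disjoint A" "disjoint B"
    using A B F unfolding finite_partition_def by auto
  have tot: "(\<Sum>a\<in>C. measure M (D \<inter> a)) = measure M D"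
    if "finite C" "\<And>c. c \<in> C \<Longrightarrow> c \<in> sets M" "\<Union>C = space M" "disjoint C" "D \<in> sets M" for C D
  proof -
    have "disjoint_family_on (\<lambda>c. D \<inter> c) C"
      unfolding disjoint_family_on_def using disjointD[OF that(4)] by blast
    from M.finite_measure_finite_Union[OF that(1) _ this]
    have "measure M (\<Union>c\<in>C. D \<inter> c) = (\<Sum>c\<in>C. measure M (D \<inter> c))"
      by (rule meta_mp)
         (use that in auto)
    moreover have "(\<Union>c\<in>C. D \<inter> c) = D" using that sets.sets_into_space[OF that(5)] by auto
    ultimately show ?thesis by simp
  qed
  have one: "(\<Sum>a\<in>C. measure M a) = 1"
    if "finite C" "\<And>c. c \<in> C \<Longrightarrow> c \<in> sets M" "\<Union>C = space M" "disjoint C" for C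
  proof -
    have "(\<Sum>a\<in>C. measure M a) = (\<Sum>a\<in>C. measure M (space M \<inter> a))"
      using that by (intro sum.cong) (auto intro!: arg_cong[where f="measure M"] dest: sets.sets_into_space)
    then show ?thesis using tot[OF that, of "space M"] by (simp add: M.prob_space)
  qed
  have "(\<Sum>a\<in>A. \<Sum>b\<in>B. \<bar>measure M (a \<inter> b) - measure M a * measure M b\<bar>)
      \<le> (\<Sum>a\<in>A. \<Sum>b\<in>B. measure M (a \<inter> b) + measure M a * measure M b)"
    by (intro sum_mono) (smt (verit) measure_nonneg mult_nonneg_nonneg)
  also have "\<dots> = (\<Sum>a\<in>A. measure M a) + (\<Sum>a\<in>A. measure M a) * (\<Sum>b\<in>B. measure M b)"
    using tot[OF fin(2) ms(2) un(2) dj(2)] ms(1) by (simp add: sum.distrib sum_product)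
  also have "\<dots> = 2"
    using one[OF fin(1) ms(1) un(1) dj(1)] one[OF fin(2) ms(2) un(2) dj(2)] by simp
  finally show ?thesis .
qed

lemma beta_sum_le_beta_coef:
  assumes M: "prob_space M" and F: "F1 \<subseteq> sets M" "F2 \<subseteq> sets M"
    and A: "finite_partition M F1 A" and B: "finite_partition M F2 B"
  shows "(\<Sum>a\<in>A. \<Sum>b\<in>B. \<bar>measure M (a \<inter> b) - measure M a * measure M b\<bar>) \<le> 2 * beta_coef M F1 F2"
proof -
  have "1/2 * (\<Sum>a\<in>fst (A, B). \<Sum>b\<in>snd (A, B). \<bar>measure M (a \<inter> b) - measure M a * measure M b\<bar>) \<le> beta_coef M F1 F2"
    unfolding beta_coef_def
  proof (rule cSUP_upper)
    show "bdd_above ((\<lambda>AB. 1/2 * (\<Sum>a\<in>fst AB. \<Sum>b\<in>snd AB. \<bar>measure M (a \<inter> b) - measure M a * measure M b\<bar>)) `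
      {(A, B). finite_partition M F1 A \<and> finite_partition M F2 B})"
      using beta_sum_le_2[OF M F] by (intro bdd_aboveI[of _ 1]) force
  qed (use A B in auto)
  then show ?thesis by simp
qed

text \<open>The image of \<open>M\<close> under the diagonal is the joint law of the two
  sub-sigma-algebras; the image of the product measure under the identity is the product of their
  marginals. These are the two laws that beta compares.\<close>

lemma diagonal_measurable:
  assumes "space F1 = space M" "sets F1 \<subseteq> sets M" "space F2 = space M" "sets F2 \<subseteq> sets M"
  shows "(\<lambda>\<omega>. (\<omega>, \<omega>)) \<in> M \<rightarrow>\<^sub>M F1 \<Otimes>\<^sub>M F2"
  using assms by (intro measurable_Pair) (auto simp: measurable_def)

lemma id_measurable_pair:
  assumes "space F1 = space M" "sets F1 \<subseteq> sets M" "space F2 = space M" "sets F2 \<subseteq> sets M"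
  shows "(\<lambda>z. z) \<in> M \<Otimes>\<^sub>M M \<rightarrow>\<^sub>M F1 \<Otimes>\<^sub>M F2"
proof -
  have "(\<lambda>z. (fst z, snd z)) \<in> M \<Otimes>\<^sub>M M \<rightarrow>\<^sub>M F1 \<Otimes>\<^sub>M F2"
  proof (intro measurable_Pair)
    show "fst \<in> M \<Otimes>\<^sub>M M \<rightarrow>\<^sub>M F1"
      by (rule measurable_compose[OF measurable_fst, of "\<lambda>x. x"]) (use assms in \<open>auto simp: measurable_def\<close>)
    show "snd \<in> M \<Otimes>\<^sub>M M \<rightarrow>\<^sub>M F2"
      by (rule measurable_compose[OF measurable_snd, of "\<lambda>x. x"]) (use assms in \<open>auto simp: measurable_def\<close>)
  qed
  then show ?thesis by simp
qed

text \<open>The coefficient only sees unions of cells of finite product grids. These form an algebra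
  generating the product sigma-algebra, and \<open>E\<close> is approximated by one of them under
  the joint and the product law simultaneously.\<close>

lemma measure_diff_le_beta_coef:
  assumes M: "prob_space M"
    and F: "space F1 = space M" "sets F1 \<subseteq> sets M" "space F2 = space M" "sets F2 \<subseteq> sets M"
    and E: "E \<in> sets (F1 \<Otimes>\<^sub>M F2)"
  shows "\<bar>measure (distr M (F1 \<Otimes>\<^sub>M F2) (\<lambda>\<omega>. (\<omega>, \<omega>))) E - measure (distr (M \<Otimes>\<^sub>M M) (F1 \<Otimes>\<^sub>M F2) (\<lambda>z. z)) E\<bar>
    \<le> 2 * beta_coef M (sets F1) (sets F2)"
    (is "\<bar>measure ?P E - measure ?Q E\<bar> \<le> ?b")
proof -
  interpret M: prob_space M by fact
  interpret MM: pair_prob_space M M ..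
  note meas = diagonal_measurable[OF F] id_measurable_pair[OF F]
  interpret P: prob_space ?P by (rule M.prob_space_distr[OF meas(1)])
  interpret Q: prob_space ?Q by (rule MM.prob_space_distr[OF meas(2)])
  have grid: "\<bar>measure ?P G - measure ?Q G\<bar> \<le> ?b" if G: "G \<in> grid_sets F1 F2" for G
  proof -
    obtain g1 g2 :: "'a \<Rightarrow> nat" and T where
      g: "g1 \<in> F1 \<rightarrow>\<^sub>M count_space UNIV" "g2 \<in> F2 \<rightarrow>\<^sub>M count_space UNIV"
        "finite (g1 ` space F1)" "finite (g2 ` space F2)"
      and GT: "G = {z \<in> space F1 \<times> space F2. (g1 (fst z), g2 (snd z)) \<in> T}"
      using G unfolding grid_sets_def by blast
    define a where "a v = g1 -` {v} \<inter> space F1" for v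
    define b where "b v = g2 -` {v} \<inter> space F2" for v
    have ab: "a v \<in> sets F1" "b v \<in> sets F2" for v
      unfolding a_def b_def using g by (auto intro: measurable_sets)
    then have abM: "a v \<in> sets M" "b v \<in> sets M" for v using F by auto
    define R where "R = (g1 ` space F1 \<times> g2 ` space F2) \<inter> T"
    have finR: "finite R" unfolding R_def using g by auto
    have G_eq: "G = (\<Union>t\<in>R. a (fst t) \<times> b (snd t))"
      unfolding GT R_def a_def b_def by force
    have dj: "disjoint_family_on (\<lambda>t. a (fst t) \<times> b (snd t)) R"
      unfolding disjoint_family_on_def a_def b_def by (auto simp: prod_eq_iff)
    have rect: "a v \<times> b w \<in> sets (F1 \<Otimes>\<^sub>M F2)" for v w using ab by auto
    have "measure ?P G = (\<Sum>t\<in>R. measure ?P (a (fst t) \<times> b (snd t)))"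
      unfolding G_eq by (rule P.finite_measure_finite_Union[OF finR _ dj]) (use rect in auto)
    also have "\<dots> = (\<Sum>t\<in>R. measure M (a (fst t) \<inter> b (snd t)))"
    proof (rule sum.cong[OF refl])
      fix t
      have "(\<lambda>\<omega>. (\<omega>, \<omega>)) -` (a (fst t) \<times> b (snd t)) \<inter> space M = a (fst t) \<inter> b (snd t)"
        using abM[THEN sets.sets_into_space] by auto
      then show "measure ?P (a (fst t) \<times> b (snd t)) = measure M (a (fst t) \<inter> b (snd t))"
        using measure_distr[OF meas(1) rect] by simp
    qed
    finally have 1: "measure ?P G = \<dots>" .
    have "measure ?Q G = (\<Sum>t\<in>R. measure ?Q (a (fst t) \<times> b (snd t)))"
      unfolding G_eq by (rule Q.finite_measure_finite_Union[OF finR _ dj]) (use rect in auto)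
    also have "\<dots> = (\<Sum>t\<in>R. measure M (a (fst t)) * measure M (b (snd t)))"
    proof (rule sum.cong[OF refl])
      fix t
      have "(\<lambda>z. z) -` (a (fst t) \<times> b (snd t)) \<inter> space (M \<Otimes>\<^sub>M M) = a (fst t) \<times> b (snd t)"
        using abM[THEN sets.sets_into_space] by (auto simp: space_pair_measure)
      then show "measure ?Q (a (fst t) \<times> b (snd t)) = measure M (a (fst t)) * measure M (b (snd t))"
        using measure_distr[OF meas(2) rect] abM
        by (simp add: measure_def M.emeasure_pair_measure_Times enn2real_mult)
    qed
    finally have 2: "measure ?Q G = \<dots>" .
    have "\<bar>measure ?P G - measure ?Q G\<bar>
        \<le> (\<Sum>t\<in>R. \<bar>measure M (a (fst t) \<inter> b (snd t)) - measure M (a (fst t)) * measure M (b (snd t))\<bar>)"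
      unfolding 1 2 sum_subtractf[symmetric] by (rule sum_abs)
    \<comment> \<open>After the absolute values are taken, the cells outside \<open>G\<close> may be
      added, which completes the sum to that of two full partitions.\<close>
    also have "\<dots> \<le> (\<Sum>t\<in>g1 ` space F1 \<times> g2 ` space F2.
        \<bar>measure M (a (fst t) \<inter> b (snd t)) - measure M (a (fst t)) * measure M (b (snd t))\<bar>)"
      by (rule sum_mono2) (use g in \<open>auto simp: R_def\<close>)
    also have "\<dots> = (\<Sum>v\<in>g1 ` space F1. \<Sum>w\<in>g2 ` space F2.
        \<bar>measure M (a v \<inter> b w) - measure M (a v) * measure M (b w)\<bar>)"
      by (simp add: sum.cartesian_product split_beta)
    also have "\<dots> = (\<Sum>x\<in>a ` g1 ` space F1. \<Sum>y\<in>b ` g2 ` space F2. \<bar>measure M (x \<inter> y) - measure M x * measure M y\<bar>)"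
    proof -
      have "inj_on a (g1 ` space F1)" "inj_on b (g2 ` space F2)"
        unfolding a_def b_def by (rule inj_on_level_sets)+
      then show ?thesis by (simp add: sum.reindex)
    qed
    also have "\<dots> \<le> ?b"
    proof (rule beta_sum_le_beta_coef[OF M F(2,4)])
      show "finite_partition M (sets F1) (a ` g1 ` space F1)"
        unfolding a_def by (rule level_sets_finite_partition[OF g(1,3) F(1)])
      show "finite_partition M (sets F2) (b ` g2 ` space F2)"
        unfolding b_def by (rule level_sets_finite_partition[OF g(2,4) F(3)])
    qed
    finally show ?thesis .
  qed
  show ?thesis
  proof (rule field_le_epsilon)
    fix e :: real assume e: "0 < e"
    have "\<exists>G\<in>grid_sets F1 F2. measure ?P ((E - G) \<union> (G - E)) < e / 2 \<and> measure ?Q ((E - G) \<union> (G - E)) < e / 2"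
    proof (rule sigma_sets_approx_by_algebra)
      show "sets ?P = sigma_sets (space ?P) {a \<times> b |a b. a \<in> sets F1 \<and> b \<in> sets F2}"
        by (simp add: sets_pair_measure space_pair_measure)
      show "{a \<times> b |a b. a \<in> sets F1 \<and> b \<in> sets F2} \<subseteq> grid_sets F1 F2"
        using rectangle_in_grid_sets by blast
      show "{} \<in> grid_sets F1 F2" using rectangle_in_grid_sets[of "{}" F1 "{}" F2] by simp
    qed (use e E grid_sets_measurable[of F1 F2] grid_sets_compl[of _ F1 F2] grid_sets_Un[of _ F1 F2] in
        \<open>auto simp: space_pair_measure intro: P.finite_measure_axioms Q.finite_measure_axioms\<close>)
    then obtain G where G: "G \<in> grid_sets F1 F2"
      and GP: "measure ?P ((E - G) \<union> (G - E)) < e / 2" and GQ: "measure ?Q ((E - G) \<union> (G - E)) < e / 2"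
      by blast
    have Gs: "G \<in> sets (F1 \<Otimes>\<^sub>M F2)" using G grid_sets_measurable by blast
    have close: "\<bar>measure R E - measure R G\<bar> \<le> measure R ((E - G) \<union> (G - E))"
      if R: "finite_measure R" "sets R = sets (F1 \<Otimes>\<^sub>M F2)" for R
    proof -
      interpret R: finite_measure R by fact
      have "measure R E \<le> measure R (G \<union> ((E - G) \<union> (G - E)))"
        by (rule R.finite_measure_mono) (use E Gs R in auto)
      also have "\<dots> \<le> measure R G + measure R ((E - G) \<union> (G - E))"
        by (rule measure_Un_le) (use E Gs R in auto)
      finally have "measure R E \<le> measure R G + measure R ((E - G) \<union> (G - E))" .
      moreover have "measure R G \<le> measure R (E \<union> ((E - G) \<union> (G - E)))"
        by (rule R.finite_measure_mono) (use E Gs R in auto)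
      moreover have "\<dots> \<le> measure R E + measure R ((E - G) \<union> (G - E))"
        by (rule measure_Un_le) (use E Gs R in auto)
      ultimately show ?thesis by linarith
    qed
    show "\<bar>measure ?P E - measure ?Q E\<bar> \<le> ?b + e"
      using close[of ?P] close[of ?Q] grid[OF G] GP GQ P.finite_measure_axioms Q.finite_measure_axioms
      by fastforce
  qed
qed

lemma beta_coef_nonneg:
  assumes M: "prob_space M"
    and F: "F1 \<subseteq> sets M" "F2 \<subseteq> sets M" "space M \<in> F1" "space M \<in> F2"
  shows "0 \<le> beta_coef M F1 F2"
proof -
  interpret M: prob_space M by fact
  have "finite_partition M F1 {space M}" "finite_partition M F2 {space M}"
    using F by (auto simp: finite_partition_def)
  from beta_sum_le_beta_coef[OF M F(1,2) this] show ?thesis by (simp add: M.prob_space)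
qed

section \<open>Coupling for the kernel\<close>

text \<open>Degeneracy is given only at points of the support, so the support must carry full mass.
  Its complement is a union of open null sets, and by Lindelof countably many of them cover
  it.\<close>

lemma AE_law_support:
  fixes Y :: "'w \<Rightarrow> 'b::second_countable_topology"
  assumes M: "prob_space M" and Y: "Y \<in> borel_measurable M"
  shows "AE \<omega> in M. Y \<omega> \<in> law_support M Y"
proof -
  interpret prob_space M by fact
  define \<U> where "\<U> = {U. open U \<and> measure M (Y -` U \<inter> space M) = 0}"
  obtain \<V> where V: "\<V> \<subseteq> \<U>" "countable \<V>" "\<Union>\<V> = \<Union>\<U>"
    using Lindelof[of \<U>] unfolding \<U>_def by blast
  have "AE \<omega> in M. \<forall>U\<in>\<V>. Y \<omega> \<notin> U"
  proof (rule AE_ball_countable')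
    fix U assume "U \<in> \<V>"
    with V have U: "open U" "measure M (Y -` U \<inter> space M) = 0" by (auto simp: \<U>_def)
    have "Y -` U \<inter> space M \<in> sets M" using Y U(1) by (auto intro: measurable_sets)
    then have "Y -` U \<inter> space M \<in> null_sets M" using U(2) by (auto simp: emeasure_eq_measure)
    then have "AE \<omega> in M. \<omega> \<notin> Y -` U \<inter> space M" by (rule AE_not_in)
    then show "AE \<omega> in M. Y \<omega> \<notin> U" using AE_space by eventually_elim auto
  qed (fact V(2))
  then show ?thesis
  proof eventually_elim
    case (elim \<omega>)
    then have "Y \<omega> \<notin> \<Union>\<U>" using V(3) by blast
    then show ?case unfolding law_support_def \<U>_def
      by (auto simp: zero_less_measure_iff less_le)
  qed
qed

lemma integrable_mult_of_squares:
  fixes u v :: "'z \<Rightarrow> real"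
  assumes "u \<in> borel_measurable R" "v \<in> borel_measurable R"
    and "integrable R (\<lambda>x. (u x)\<^sup>2)" "integrable R (\<lambda>x. (v x)\<^sup>2)"
  shows "integrable R (\<lambda>x. u x * v x)"
proof (rule Bochner_Integration.integrable_bound)
  show "integrable R (\<lambda>x. (u x)\<^sup>2 + (v x)\<^sup>2)" using assms by simp
  show "AE x in R. norm (u x * v x) \<le> norm ((u x)\<^sup>2 + (v x)\<^sup>2)"
  proof (rule AE_I2)
    fix x
    have "2 * (\<bar>u x\<bar> * \<bar>v x\<bar>) \<le> (u x)\<^sup>2 + (v x)\<^sup>2"
      using sum_squares_bound[of "\<bar>u x\<bar>" "\<bar>v x\<bar>"] by simp
    moreover have "0 \<le> \<bar>u x\<bar> * \<bar>v x\<bar>" by simp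
    ultimately have "\<bar>u x\<bar> * \<bar>v x\<bar> \<le> (u x)\<^sup>2 + (v x)\<^sup>2" by linarith
    then show "norm (u x * v x) \<le> norm ((u x)\<^sup>2 + (v x)\<^sup>2)" by (simp add: abs_mult)
  qed
qed (use assms in auto)

lemma Lnorm_distr:
  assumes "g \<in> R \<rightarrow>\<^sub>M R'" "f \<in> borel_measurable R'"
  shows "Lnorm (distr R R' g) f p = Lnorm R (\<lambda>x. f (g x)) p"
  unfolding Lnorm_def using assms by (subst nn_integral_distr) auto

lemma Lnorm_const:
  assumes "prob_space R" "0 < p"
  shows "Lnorm R (\<lambda>_. c) p = ennreal \<bar>c\<bar>"
proof -
  interpret prob_space R by fact
  show ?thesis unfolding Lnorm_def enn_rpow_def
    using assms(2) by (simp add: emeasure_space_1 powr_powr)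
qed

text \<open>Young's inequality for |f| and the constant K^(p - 1) gives |f| K^(p - 1) at most |f|^p
  / p + K^p / q; after integration the right side is at most K^p as soon as K exceeds the
  norm.\<close>

lemma Lnorm_mean:
  assumes R: "prob_space R" and f: "integrable R f" and p: "1 < p"
  shows "ennreal \<bar>\<integral>x. f x \<partial>R\<bar> \<le> Lnorm R f p"
proof (cases "Lnorm R f p = \<infinity>")
  case False
  interpret prob_space R by fact
  define c where "c = enn2real (Lnorm R f p)"
  have c: "Lnorm R f p = ennreal c" and c0: "0 \<le> c" using False by (auto simp: c_def less_top)
  have [measurable]: "f \<in> borel_measurable R" using f by auto
  have "\<bar>\<integral>x. f x \<partial>R\<bar> \<le> K" if K: "c < K" for K
  proof -
    have K0: "0 < K" using K c0 by simp
    have m: "(\<integral>\<^sup>+x. ennreal (\<bar>f x\<bar> powr p) \<partial>R) \<le> ennreal (K powr p)"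
      by (rule nn_integral_le_of_Lnorm) (use c K c0 p in \<open>auto intro: ennreal_leI\<close>)
    have ip: "integrable R (\<lambda>x. \<bar>f x\<bar> powr p)"
      using m by (intro integrableI_nonneg) (auto intro: order.strict_trans1)
    have "ennreal (\<integral>x. \<bar>f x\<bar> powr p \<partial>R) \<le> ennreal (K powr p)"
      using m ip by (subst nn_integral_eq_integral[symmetric]) auto
    then have le: "(\<integral>x. \<bar>f x\<bar> powr p \<partial>R) \<le> K powr p" by (simp add: ennreal_le_iff)
    define q where "q = p / (p - 1)"
    have q: "1 < q" "1 / p + 1 / q = 1" using p by (auto simp: q_def field_simps)
    have Kq: "(K powr (p - 1)) powr q = K powr p" using p by (simp add: q_def powr_powr)
    have young: "\<bar>f x\<bar> * K powr (p - 1) \<le> \<bar>f x\<bar> powr p / p + K powr p / q" for x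
      using Youngs_inequality[of p q "\<bar>f x\<bar>" "K powr (p - 1)"] p q Kq by simp
    have "\<bar>\<integral>x. f x \<partial>R\<bar> * K powr (p - 1) \<le> (\<integral>x. \<bar>f x\<bar> \<partial>R) * K powr (p - 1)"
      by (intro mult_right_mono integral_abs_bound) auto
    also have "\<dots> = (\<integral>x. \<bar>f x\<bar> * K powr (p - 1) \<partial>R)" using f by simp
    also have "\<dots> \<le> (\<integral>x. \<bar>f x\<bar> powr p / p + K powr p / q \<partial>R)"
      by (rule integral_mono) (use f ip young in auto)
    also have "\<dots> = (\<integral>x. \<bar>f x\<bar> powr p \<partial>R) / p + K powr p / q" using ip by (simp add: prob_space)
    also have "\<dots> \<le> K powr p / p + K powr p / q" using le p by (simp add: divide_right_mono)
    also have "\<dots> = K powr p * (1 / p + 1 / q)" by (simp add: algebra_simps)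
    also have "\<dots> = K * K powr (p - 1)" using q K0 by (simp add: powr_mult_base)
    finally show ?thesis using K0 by simp
  qed
  then have "\<bar>\<integral>x. f x \<partial>R\<bar> \<le> c" by (rule dense_ge)
  then show ?thesis unfolding c by (rule ennreal_leI)
qed simp

lemma ennreal_abs_add_le: "ennreal \<bar>a + b\<bar> \<le> ennreal \<bar>a\<bar> + ennreal \<bar>b\<bar>"
  using ennreal_leI[OF abs_triangle_ineq[of a b]] by simp

lemma ennreal_abs_diff_le: "ennreal \<bar>a - b\<bar> \<le> ennreal \<bar>a\<bar> + ennreal \<bar>b\<bar>"
  using ennreal_abs_add_le[of a "- b"] by simp

text \<open>The situation for one fixed \<open>n\<close>, with \<open>\<beta>\<close> in the role of
  beta_4(m). In the mixing condition a singleton always stands in the first group. Second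
  countability is what \<open>AE_law_support\<close> asks of the state space.\<close>

locale mixing_ustat = prob_space M for M :: "'w measure" +
  fixes I :: "'i set" and d :: "'i \<Rightarrow> 'i \<Rightarrow> ereal"
    and X :: "'i \<Rightarrow> 'w \<Rightarrow> 'b::second_countable_topology"
    and H :: "'b \<Rightarrow> 'b \<Rightarrow> real" and m \<beta> \<delta> :: real
  assumes finI: "finite I"
    and X_meas: "\<And>i. i \<in> I \<Longrightarrow> X i \<in> borel_measurable M"
    and d_nonneg: "\<And>i j. i \<in> I \<Longrightarrow> j \<in> I \<Longrightarrow> 0 \<le> d i j"
    and d_refl: "\<And>i. i \<in> I \<Longrightarrow> d i i = 0"
    and d_sym: "\<And>i j. i \<in> I \<Longrightarrow> j \<in> I \<Longrightarrow> d i j = d j i"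
    and d_ge_1: "\<And>i j. i \<in> I \<Longrightarrow> j \<in> I \<Longrightarrow> i \<noteq> j \<Longrightarrow> 1 \<le> d i j"
    and mixing: "\<And>J1 J2. J1 \<subseteq> I \<Longrightarrow> J2 \<subseteq> I \<Longrightarrow>
      card J1 \<le> 1 \<and> card J2 \<le> 3 \<or> card J1 \<le> 2 \<and> card J2 \<le> 2 \<Longrightarrow>
      ereal m \<le> set_dist d J1 J2 \<Longrightarrow> beta_coef M (gen_sigma M X J1) (gen_sigma M X J2) \<le> \<beta>"
    and H_meas: "(\<lambda>z. H (fst z) (snd z)) \<in> borel_measurable (borel \<Otimes>\<^sub>M borel)"
    and H_sym: "\<And>x y. H x y = H y x"
    and H_L2: "\<And>i j. i \<in> I \<Longrightarrow> j \<in> I \<Longrightarrow> i \<noteq> j \<Longrightarrow> tilde_moment M (X i) (X j) H 2 < \<infinity>"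
    and degen: "degenerate M I X H"
    and delta_pos: "0 < \<delta>"
begin

sublocale MM: pair_prob_space M M ..

abbreviation Hn :: "real \<Rightarrow> ennreal" where "Hn p \<equiv> Hnorm M I X H p"

definition err :: ennreal where
  "err = (Hn (2 + \<delta>))\<^sup>2 * ennreal (\<beta> powr (\<delta> / (2 + \<delta>)))"

text \<open>The sigma-algebra generated by a group of variables, packaged as a measure so that
  measurability on products of two groups can be expressed.\<close>

definition S :: "'i set \<Rightarrow> 'w measure" where
  "S J = sigma (space M) (\<Union>i\<in>J. {X i -` B \<inter> space M | B. B \<in> sets borel})"

lemma space_S [simp]: "space (S J) = space M"
  unfolding S_def by (rule space_measure_of) auto

lemma sets_S: "sets (S J) = gen_sigma M X J"
  unfolding S_def gen_sigma_def by (rule sets_measure_of) auto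

lemma sets_S_subset: "J \<subseteq> I \<Longrightarrow> sets (S J) \<subseteq> sets M"
  unfolding sets_S gen_sigma_def using X_meas
  by (intro sets.sigma_sets_subset) (auto intro: measurable_sets)

lemma X_measurable_S: "i \<in> J \<Longrightarrow> X i \<in> borel_measurable (S J)"
  by (rule measurableI) (auto simp: sets_S gen_sigma_def)

lemma H_measurable:
  assumes "f \<in> borel_measurable R" "g \<in> borel_measurable R"
  shows "(\<lambda>x. H (f x) (g x)) \<in> borel_measurable R"
  using measurable_compose[OF measurable_Pair[OF assms] H_meas] by simp

lemma HX_measurable: "i \<in> I \<Longrightarrow> k \<in> I \<Longrightarrow> (\<lambda>\<omega>. H (X i \<omega>) (X k \<omega>)) \<in> borel_measurable M"
  by (intro H_measurable X_meas)

lemma HX_tilde_measurable: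
  "i \<in> I \<Longrightarrow> k \<in> I \<Longrightarrow> (\<lambda>z. H (X i (fst z)) (X k (snd z))) \<in> borel_measurable (M \<Otimes>\<^sub>M M)"
  by (intro H_measurable measurable_compose[OF measurable_fst] measurable_compose[OF measurable_snd] X_meas)

lemma distr_pair_X:
  assumes "i \<in> I" "k \<in> I"
  shows "distr M borel (X i) \<Otimes>\<^sub>M distr M borel (X k)
    = distr (M \<Otimes>\<^sub>M M) (borel \<Otimes>\<^sub>M borel) (\<lambda>(x, y). (X i x, X k y))"
  using assms X_meas
  by (intro pair_measure_distr prob_space_imp_sigma_finite prob_space_distr) auto

lemma pair_X_measurable:
  assumes "i \<in> I" "k \<in> I"
  shows "(\<lambda>(x, y). (X i x, X k y)) \<in> M \<Otimes>\<^sub>M M \<rightarrow>\<^sub>M borel \<Otimes>\<^sub>M borel"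
  using X_meas[OF assms(1)] X_meas[OF assms(2)] by measurable

lemma tilde_moment_eq:
  assumes "i \<in> I" "k \<in> I"
  shows "tilde_moment M (X i) (X k) H p
    = (\<integral>\<^sup>+z. ennreal (\<bar>H (X i (fst z)) (X k (snd z))\<bar> powr p) \<partial>(M \<Otimes>\<^sub>M M))"
proof -
  note [measurable] = H_meas
  show ?thesis unfolding tilde_moment_def distr_pair_X[OF assms]
    by (subst nn_integral_distr[OF pair_X_measurable[OF assms]]) (auto simp: split_beta)
qed

text \<open>This is the summand of sigma^2: the second factor of the product space supplies the
  independent copy of X_k.\<close>

definition h :: "'i \<Rightarrow> 'i \<Rightarrow> real" where
  "h i k = (\<integral>z. (H (X i (fst z)) (X k (snd z)))\<^sup>2 \<partial>(M \<Otimes>\<^sub>M M))"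

lemma sigma2_eq: "sigma2 M I X H = (\<Sum>(i, k)\<in>{(i, k). i \<in> I \<and> k \<in> I \<and> i \<noteq> k}. h i k)"
  unfolding sigma2_def
proof (rule sum.cong[OF refl], clarsimp)
  fix i k assume ik: "i \<in> I" "k \<in> I"
  note [measurable] = H_meas
  show "(\<integral>z. (H (fst z) (snd z))\<^sup>2 \<partial>(distr M borel (X i) \<Otimes>\<^sub>M distr M borel (X k))) = h i k"
    unfolding distr_pair_X[OF ik] h_def
    by (subst integral_distr[OF pair_X_measurable[OF ik]]) (auto simp: split_beta)
qed

lemma powr_2_abs: "\<bar>x :: real\<bar> powr 2 = x\<^sup>2"
  by (cases "x = 0") auto

lemma tilde_L2:
  assumes "i \<in> I" "k \<in> I" "i \<noteq> k"
  shows "integrable (M \<Otimes>\<^sub>M M) (\<lambda>z. (H (X i (fst z)) (X k (snd z)))\<^sup>2)"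
  using H_L2[OF assms] HX_tilde_measurable[OF assms(1,2)] unfolding tilde_moment_eq[OF assms(1,2)]
  by (intro integrableI_nonneg) (auto simp: powr_2_abs)

lemma h_sym:
  assumes "i \<in> I" "k \<in> I"
  shows "h i k = h k i"
proof -
  have "(\<integral>(x, y). (H (X k x) (X i y))\<^sup>2 \<partial>(M \<Otimes>\<^sub>M M)) = (\<integral>(x, y). (H (X k y) (X i x))\<^sup>2 \<partial>(M \<Otimes>\<^sub>M M))"
    using MM.integral_product_swap[of "\<lambda>(x, y). (H (X k x) (X i y))\<^sup>2"] HX_tilde_measurable[OF assms(2,1)]
    by (simp add: split_beta')
  then show ?thesis unfolding h_def by (simp add: split_beta' H_sym[of "X i _"])
qed

lemma degenerate_AE:
  assumes "i \<in> I" "k \<in> I"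
  shows "AE \<omega>' in M. (\<integral>\<omega>. H (X i \<omega>) (X k \<omega>') \<partial>M) = 0"
  using AE_law_support[OF prob_space_axioms X_meas[OF assms(2)]]
proof eventually_elim
  case (elim \<omega>')
  then show ?case using degen assms unfolding degenerate_def by blast
qed

lemma Lnorm_joint_le:
  assumes "i \<in> I" "k \<in> I" "i \<noteq> k"
  shows "Lnorm M (\<lambda>\<omega>. H (X i \<omega>) (X k \<omega>)) p \<le> Hn p"
  unfolding Lnorm_def Hnorm_def joint_moment_def
  by (rule SUP_upper2[of "(i, k)"]) (use assms in auto)

lemma Lnorm_tilde_le:
  assumes "i \<in> I" "k \<in> I" "i \<noteq> k"
  shows "Lnorm (M \<Otimes>\<^sub>M M) (\<lambda>z. H (X i (fst z)) (X k (snd z))) p \<le> Hn p"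
  unfolding Lnorm_def Hnorm_def tilde_moment_eq[OF assms(1,2), symmetric]
  by (rule SUP_upper2[of "(i, k)"]) (use assms in auto)

lemma nn_integral_pair_fst:
  assumes "f \<in> borel_measurable M"
  shows "(\<integral>\<^sup>+z. f (fst z) \<partial>(M \<Otimes>\<^sub>M M)) = (\<integral>\<^sup>+\<omega>. f \<omega> \<partial>M)"
proof -
  note [measurable] = assms
  have "(\<integral>\<^sup>+z. f (fst z) \<partial>(M \<Otimes>\<^sub>M M)) = (\<integral>\<^sup>+\<omega>. \<integral>\<^sup>+\<omega>'. f \<omega> \<partial>M \<partial>M)"
    by (subst nn_integral_fst[symmetric]) auto
  then show ?thesis by (simp add: emeasure_space_1)
qed

lemma nn_integral_pair_snd:
  assumes "f \<in> borel_measurable M"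
  shows "(\<integral>\<^sup>+z. f (snd z) \<partial>(M \<Otimes>\<^sub>M M)) = (\<integral>\<^sup>+\<omega>. f \<omega> \<partial>M)"
proof -
  note [measurable] = assms
  have "(\<integral>\<^sup>+z. f (snd z) \<partial>(M \<Otimes>\<^sub>M M)) = (\<integral>\<^sup>+\<omega>. \<integral>\<^sup>+\<omega>'. f \<omega>' \<partial>M \<partial>M)"
    by (subst nn_integral_fst[symmetric]) auto
  then show ?thesis by (simp add: emeasure_space_1)
qed

lemma Lnorm_pair_fst:
  "f \<in> borel_measurable M \<Longrightarrow> Lnorm (M \<Otimes>\<^sub>M M) (\<lambda>z. f (fst z)) p = Lnorm M f p"
  unfolding Lnorm_def by (subst nn_integral_pair_fst) auto

lemma Lnorm_pair_snd:
  "f \<in> borel_measurable M \<Longrightarrow> Lnorm (M \<Otimes>\<^sub>M M) (\<lambda>z. f (snd z)) p = Lnorm M f p"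
  unfolding Lnorm_def by (subst nn_integral_pair_snd) auto

lemma beta_coef_S:
  assumes "J1 \<subseteq> I" "J2 \<subseteq> I"
    and "card J1 \<le> 1 \<and> card J2 \<le> 3 \<or> card J1 \<le> 2 \<and> card J2 \<le> 2"
    and "\<And>i j. i \<in> J1 \<Longrightarrow> j \<in> J2 \<Longrightarrow> ereal m \<le> d i j"
  shows "0 \<le> beta_coef M (sets (S J1)) (sets (S J2))" "beta_coef M (sets (S J1)) (sets (S J2)) \<le> \<beta>"
proof -
  show "0 \<le> beta_coef M (sets (S J1)) (sets (S J2))"
    using sets_S_subset[OF assms(1)] sets_S_subset[OF assms(2)] sets.top[of "S J1"] sets.top[of "S J2"]
    by (intro beta_coef_nonneg prob_space_axioms) auto
  have "ereal m \<le> set_dist d J1 J2" unfolding set_dist_def using assms(4) by (auto intro!: INF_greatest)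
  then show "beta_coef M (sets (S J1)) (sets (S J2)) \<le> \<beta>"
    unfolding sets_S using assms by (intro mixing)
qed

text \<open>On the diagonal a function of two sample points is an ordinary random variable; on the
  product space the group \<open>J1\<close> reads the first point and \<open>J2\<close> the second,
  so the groups are independent. Keeping the two kernel factors \<open>u\<close> and
  \<open>v\<close> apart lets each be measured in L^(2+delta).\<close>

lemma coupling:
  assumes J: "J1 \<subseteq> I" "J2 \<subseteq> I" "card J1 \<le> 1 \<and> card J2 \<le> 3 \<or> card J1 \<le> 2 \<and> card J2 \<le> 2"
    "\<And>i j. i \<in> J1 \<Longrightarrow> j \<in> J2 \<Longrightarrow> ereal m \<le> d i j"
    and u: "u \<in> borel_measurable (S J1 \<Otimes>\<^sub>M S J2)" and v: "v \<in> borel_measurable (S J1 \<Otimes>\<^sub>M S J2)"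
    and uvM: "integrable M (\<lambda>\<omega>. u (\<omega>, \<omega>) * v (\<omega>, \<omega>))"
    and uvMM: "integrable (M \<Otimes>\<^sub>M M) (\<lambda>z. u z * v z)"
    and L: "Lnorm M (\<lambda>\<omega>. u (\<omega>, \<omega>)) (2 + \<delta>) \<le> Hn (2 + \<delta>)" "Lnorm M (\<lambda>\<omega>. v (\<omega>, \<omega>)) (2 + \<delta>) \<le> Hn (2 + \<delta>)"
      "Lnorm (M \<Otimes>\<^sub>M M) u (2 + \<delta>) \<le> Hn (2 + \<delta>)" "Lnorm (M \<Otimes>\<^sub>M M) v (2 + \<delta>) \<le> Hn (2 + \<delta>)"
  shows "ennreal \<bar>(\<integral>\<omega>. u (\<omega>, \<omega>) * v (\<omega>, \<omega>) \<partial>M) - (\<integral>z. u z * v z \<partial>(M \<Otimes>\<^sub>M M))\<bar> \<le> 8 * err"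
proof -
  let ?N = "S J1 \<Otimes>\<^sub>M S J2"
  let ?P = "distr M ?N (\<lambda>\<omega>. (\<omega>, \<omega>))" and ?Q = "distr (M \<Otimes>\<^sub>M M) ?N (\<lambda>z. z)"
  define bc where "bc = beta_coef M (sets (S J1)) (sets (S J2))"
  have bc: "0 \<le> bc" "bc \<le> \<beta>" unfolding bc_def using beta_coef_S[OF J] by auto
  have F: "space (S J1) = space M" "sets (S J1) \<subseteq> sets M" "space (S J2) = space M" "sets (S J2) \<subseteq> sets M"
    using J sets_S_subset by auto
  note meas = diagonal_measurable[OF F] id_measurable_pair[OF F]
  define r where "r = \<delta> / (2 + \<delta>)"
  have r: "0 < r" "r < 1" using delta_pos by (auto simp: r_def)
  have uv: "(\<lambda>x. u x * v x) \<in> borel_measurable ?N" using u v by simp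
  have iP: "integrable ?P (\<lambda>x. u x * v x)" using integrable_distr_eq[OF meas(1) uv] uvM by simp
  have iQ: "integrable ?Q (\<lambda>x. u x * v x)" using integrable_distr_eq[OF meas(2) uv] uvMM by simp
  have "ennreal \<bar>(\<integral>x. u x * v x \<partial>?P) - (\<integral>x. u x * v x \<partial>?Q)\<bar>
      \<le> 4 * (Hn (2 + \<delta>))\<^sup>2 * ennreal ((2 * bc) powr (\<delta> / (2 + \<delta>)))"
  proof (rule integral_mult_diff_le_Lnorm[OF _ _ _ _ _ _ _ iP iQ delta_pos])
    show "prob_space ?P" by (rule prob_space_distr[OF meas(1)])
    show "prob_space ?Q" by (rule MM.prob_space_distr[OF meas(2)])
    show "\<bar>measure ?P E - measure ?Q E\<bar> \<le> 2 * bc" if "E \<in> sets ?P" for E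
      unfolding bc_def using that by (intro measure_diff_le_beta_coef prob_space_axioms F) simp
    show "Lnorm ?P u (2 + \<delta>) \<le> Hn (2 + \<delta>)" "Lnorm ?P v (2 + \<delta>) \<le> Hn (2 + \<delta>)"
      using L u v by (simp_all add: Lnorm_distr[OF meas(1)])
    show "Lnorm ?Q u (2 + \<delta>) \<le> Hn (2 + \<delta>)" "Lnorm ?Q v (2 + \<delta>) \<le> Hn (2 + \<delta>)"
      using L u v by (simp_all add: Lnorm_distr[OF meas(2)])
  qed (use bc u v in auto)
  also have "(\<integral>x. u x * v x \<partial>?P) = (\<integral>\<omega>. u (\<omega>, \<omega>) * v (\<omega>, \<omega>) \<partial>M)"
    by (rule integral_distr[OF meas(1) uv])
  also have "(\<integral>x. u x * v x \<partial>?Q) = (\<integral>z. u z * v z \<partial>(M \<Otimes>\<^sub>M M))"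
    by (rule integral_distr[OF meas(2) uv])
  also have "4 * (Hn (2 + \<delta>))\<^sup>2 * ennreal ((2 * bc) powr (\<delta> / (2 + \<delta>)))
      \<le> 4 * (Hn (2 + \<delta>))\<^sup>2 * (2 * ennreal (\<beta> powr r))"
  \<comment> \<open>As r < 1, the factor 2 in front of the mixing coefficient grows to at most 2
    after taking the power.\<close>
  proof (rule mult_left_mono)
    have "(2 * bc) powr r = 2 powr r * bc powr r" using bc by (simp add: powr_mult)
    also have "\<dots> \<le> 2 powr 1 * \<beta> powr r"
      using bc r by (intro mult_mono powr_mono powr_mono2) auto
    finally have "ennreal ((2 * bc) powr r) \<le> ennreal (2 * \<beta> powr r)" by (simp add: ennreal_leI)
    then show "ennreal ((2 * bc) powr (\<delta> / (2 + \<delta>))) \<le> 2 * ennreal (\<beta> powr r)"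
      unfolding r_def by (simp add: ennreal_mult')
  qed simp
  also have "\<dots> = 8 * err" unfolding err_def r_def by (simp add: mult_ac)
  finally show ?thesis .
qed

text \<open>If \<open>\<beta>\<close> is 0 then \<open>err\<close> is 0 even for an infinite norm
  and says nothing about joint moments. In that case the separated variables are independent, and
  the assumed moment of the independent copy takes over.\<close>

lemma joint_moment_eq_tilde_moment:
  assumes ik: "i \<in> I" "k \<in> I" and sep: "ereal m \<le> d i k" and b0: "\<beta> = 0"
  shows "joint_moment M (X i) (X k) H p = tilde_moment M (X i) (X k) H p"
proof -
  let ?N = "S {i} \<Otimes>\<^sub>M S {k}"
  let ?P = "distr M ?N (\<lambda>\<omega>. (\<omega>, \<omega>))" and ?Q = "distr (M \<Otimes>\<^sub>M M) ?N (\<lambda>z. z)"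
  have F: "space (S {i}) = space M" "sets (S {i}) \<subseteq> sets M" "space (S {k}) = space M" "sets (S {k}) \<subseteq> sets M"
    using ik sets_S_subset by auto
  note meas = diagonal_measurable[OF F] id_measurable_pair[OF F]
  have "beta_coef M (sets (S {i})) (sets (S {k})) = 0"
    using beta_coef_S[of "{i}" "{k}"] ik sep b0 by force
  then have "measure ?P E = measure ?Q E" if "E \<in> sets ?N" for E
    using measure_diff_le_beta_coef[OF prob_space_axioms F that] by simp
  then have PQ: "?P = ?Q"
    by (intro prob_measure_eqI prob_space_distr[OF meas(1)] MM.prob_space_distr[OF meas(2)]) auto
  have Hm: "(\<lambda>z. H (X i (fst z)) (X k (snd z))) \<in> borel_measurable ?N"
    by (intro H_measurable measurable_compose[OF measurable_fst] measurable_compose[OF measurable_snd]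
        X_measurable_S) auto
  let ?f = "\<lambda>z. ennreal (\<bar>H (X i (fst z)) (X k (snd z))\<bar> powr p)"
  have f: "?f \<in> borel_measurable ?N" using Hm by measurable
  have "joint_moment M (X i) (X k) H p = (\<integral>\<^sup>+z. ?f z \<partial>?P)"
    unfolding joint_moment_def using f by (subst nn_integral_distr[OF meas(1)]) auto
  also have "\<dots> = tilde_moment M (X i) (X k) H p"
    unfolding PQ tilde_moment_eq[OF ik] using f by (intro nn_integral_distr[OF meas(2)]) auto
  finally show ?thesis .
qed

end

section \<open>Covariances over a single quadruple of indices\<close>

text \<open>The additional assumption makes the covariances below genuine: Bochner integrals of
  nonintegrable functions are 0 by convention.\<close>

locale mixing_ustat_L2 = mixing_ustat M I d X H m \<beta> \<delta>
  for M :: "'w measure" and I :: "'i set" and d :: "'i \<Rightarrow> 'i \<Rightarrow> ereal"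
    and X :: "'i \<Rightarrow> 'w \<Rightarrow> 'b::second_countable_topology"
    and H :: "'b \<Rightarrow> 'b \<Rightarrow> real" and m \<beta> \<delta> :: real +
  assumes joint_L2: "\<And>i k. i \<in> I \<Longrightarrow> k \<in> I \<Longrightarrow> i \<noteq> k \<Longrightarrow> integrable M (\<lambda>\<omega>. (H (X i \<omega>) (X k \<omega>))\<^sup>2)"
begin

definition E1 :: "'i \<Rightarrow> 'i \<Rightarrow> real" where
  "E1 i k = (\<integral>\<omega>. H (X i \<omega>) (X k \<omega>) \<partial>M)"

definition E2 :: "'i \<Rightarrow> 'i \<Rightarrow> 'i \<Rightarrow> 'i \<Rightarrow> real" where
  "E2 i k j l = (\<integral>\<omega>. H (X i \<omega>) (X k \<omega>) * H (X j \<omega>) (X l \<omega>) \<partial>M)"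

text \<open>For i different from k at most one of the two summands is nonzero. As a sum of two
  indicators it adds up to \<open>2 * h i k\<close> when (j, l) runs over all pairs.\<close>

definition diag_term :: "'i \<Rightarrow> 'i \<Rightarrow> 'i \<Rightarrow> 'i \<Rightarrow> real" where
  "diag_term i k j l = (if i = j \<and> k = l then h i k else 0) + (if i = l \<and> k = j then h i k else 0)"

text \<open>The covariance without its contribution to 2 sigma^2. It is invariant under exchanging
  the entries of either pair and under exchanging the pairs, so a singleton can be moved to the
  first position.\<close>

definition G :: "'i \<Rightarrow> 'i \<Rightarrow> 'i \<Rightarrow> 'i \<Rightarrow> real" where
  "G i k j l = E2 i k j l - E1 i k * E1 j l - diag_term i k j l"

lemma E2_swap_left: "E2 k i j l = E2 i k j l"
  unfolding E2_def by (subst H_sym) (rule refl)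

lemma E1_swap: "E1 k i = E1 i k"
  unfolding E1_def by (subst H_sym) (rule refl)

lemma diag_term_swap_left:
  assumes "i \<in> I" "k \<in> I"
  shows "diag_term k i j l = diag_term i k j l"
  unfolding diag_term_def h_sym[OF assms]
  by (cases "k = j"; cases "i = l"; cases "k = l"; cases "i = j"; simp)

lemma diag_term_swap_pairs:
  assumes "i \<in> I" "k \<in> I"
  shows "diag_term j l i k = diag_term i k j l"
proof -
  have "(if j = i \<and> l = k then h j l else 0) = (if i = j \<and> k = l then h i k else 0)" by auto
  moreover have "(if j = k \<and> l = i then h j l else 0) = (if i = l \<and> k = j then h i k else 0)"
    using h_sym[OF assms] by auto
  ultimately show ?thesis unfolding diag_term_def by simp
qed

lemma G_swap_left:
  assumes "i \<in> I" "k \<in> I"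
  shows "G k i j l = G i k j l"
  unfolding G_def E2_swap_left[of k i] E1_swap[of k i] diag_term_swap_left[OF assms] ..

lemma G_swap_pairs:
  assumes "i \<in> I" "k \<in> I"
  shows "G j l i k = G i k j l"
  unfolding G_def diag_term_swap_pairs[OF assms] E2_def by (simp add: mult.commute)

lemma G_swap_right:
  assumes "i \<in> I" "k \<in> I" "j \<in> I" "l \<in> I"
  shows "G i k l j = G i k j l"
  using G_swap_pairs[of i k l j] G_swap_left[of j l i k] G_swap_pairs[of i k j l] assms by simp

lemma joint_integrable:
  assumes "i \<in> I" "k \<in> I" "i \<noteq> k"
  shows "integrable M (\<lambda>\<omega>. H (X i \<omega>) (X k \<omega>))"
  by (rule square_integrable_imp_integrable[OF HX_measurable[OF assms(1,2)] joint_L2[OF assms]])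

lemma joint_mult_integrable:
  assumes "i \<in> I" "k \<in> I" "i \<noteq> k" "j \<in> I" "l \<in> I" "j \<noteq> l"
  shows "integrable M (\<lambda>\<omega>. H (X i \<omega>) (X k \<omega>) * H (X j \<omega>) (X l \<omega>))"
  by (intro integrable_mult_of_squares HX_measurable joint_L2 assms)

lemma integrable_pair_fst:
  fixes f :: "'w \<Rightarrow> real"
  assumes "integrable M f"
  shows "integrable (M \<Otimes>\<^sub>M M) (\<lambda>z. f (fst z))"
  by (rule integrable_distr[OF measurable_fst]) (simp add: distr_pair_fst assms)

lemma integrable_pair_snd:
  fixes f :: "'w \<Rightarrow> real"
  assumes "integrable M f"
  shows "integrable (M \<Otimes>\<^sub>M M) (\<lambda>z. f (snd z))"
  using MM.integrable_product_swap[OF integrable_pair_fst[OF assms]] by (simp add: split_beta')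

lemma tilde_integrable:
  assumes "i \<in> I" "k \<in> I" "i \<noteq> k"
  shows "integrable (M \<Otimes>\<^sub>M M) (\<lambda>z. H (X i (fst z)) (X k (snd z)))"
  by (rule MM.square_integrable_imp_integrable[OF HX_tilde_measurable[OF assms(1,2)] tilde_L2[OF assms]])

lemma integral_pair_fst_snd:
  fixes f g :: "'w \<Rightarrow> real"
  assumes "integrable M f" "integrable M g" "integrable (M \<Otimes>\<^sub>M M) (\<lambda>z. f (fst z) * g (snd z))"
  shows "(\<integral>z. f (fst z) * g (snd z) \<partial>(M \<Otimes>\<^sub>M M)) = (\<integral>\<omega>. f \<omega> \<partial>M) * (\<integral>\<omega>. g \<omega> \<partial>M)"
  using MM.integral_fst'[OF assms(3)] assms by simp

text \<open>The factor \<open>g\<close> depends on the second point only, so X_i can be integrated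
  out first with X_k frozen; degeneracy makes the inner integral vanish almost surely.\<close>

lemma integral_tilde_degenerate:
  assumes ik: "i \<in> I" "k \<in> I" "i \<noteq> k"
    and int: "integrable (M \<Otimes>\<^sub>M M) (\<lambda>z. H (X i (fst z)) (X k (snd z)) * g (snd z))"
  shows "(\<integral>z. H (X i (fst z)) (X k (snd z)) * g (snd z) \<partial>(M \<Otimes>\<^sub>M M)) = 0"
proof -
  have int': "integrable (M \<Otimes>\<^sub>M M) (\<lambda>(x, y). H (X i x) (X k y) * g y)"
    using int by (simp add: split_beta')
  have "(\<integral>z. H (X i (fst z)) (X k (snd z)) * g (snd z) \<partial>(M \<Otimes>\<^sub>M M))
      = (\<integral>(x, y). H (X i x) (X k y) * g y \<partial>(M \<Otimes>\<^sub>M M))"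
    by (simp add: split_beta')
  also have "\<dots> = (\<integral>y. (\<integral>x. H (X i x) (X k y) * g y \<partial>M) \<partial>M)"
    by (rule MM.integral_snd[OF int', symmetric])
  also have "\<dots> = (\<integral>y. (\<integral>x. H (X i x) (X k y) \<partial>M) * g y \<partial>M)" by simp
  also have "\<dots> = 0"
  proof (rule integral_eq_zero_AE)
    show "AE y in M. (\<integral>x. H (X i x) (X k y) \<partial>M) * g y = 0"
      using degenerate_AE[OF ik(1,2)] by eventually_elim simp
  qed
  finally show ?thesis .
qed

section \<open>Decoupling estimates according to the separation of the four indices\<close>

lemma HX_S_measurable:
  assumes "i \<in> J1" "k \<in> J2"
  shows "(\<lambda>z. H (X i (fst z)) (X k (snd z))) \<in> borel_measurable (S J1 \<Otimes>\<^sub>M S J2)"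
  by (intro H_measurable measurable_compose[OF measurable_fst] measurable_compose[OF measurable_snd]
      X_measurable_S assms)

lemma HX_S_fst_measurable:
  assumes "i \<in> J1" "k \<in> J1"
  shows "(\<lambda>z. H (X i (fst z)) (X k (fst z))) \<in> borel_measurable (S J1 \<Otimes>\<^sub>M S J2)"
  by (intro H_measurable measurable_compose[OF measurable_fst] X_measurable_S assms)

lemma HX_S_snd_measurable:
  assumes "i \<in> J2" "k \<in> J2"
  shows "(\<lambda>z. H (X i (snd z)) (X k (snd z))) \<in> borel_measurable (S J1 \<Otimes>\<^sub>M S J2)"
  by (intro H_measurable measurable_compose[OF measurable_snd] X_measurable_S assms)

lemma Lnorm_joint_fst_le:
  "\<lbrakk>i \<in> I; k \<in> I; i \<noteq> k\<rbrakk> \<Longrightarrow> Lnorm (M \<Otimes>\<^sub>M M) (\<lambda>z. H (X i (fst z)) (X k (fst z))) p \<le> Hn p"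
  by (subst Lnorm_pair_fst[OF HX_measurable]) (auto intro: Lnorm_joint_le)

lemma Lnorm_joint_snd_le:
  "\<lbrakk>i \<in> I; k \<in> I; i \<noteq> k\<rbrakk> \<Longrightarrow> Lnorm (M \<Otimes>\<^sub>M M) (\<lambda>z. H (X i (snd z)) (X k (snd z))) p \<le> Hn p"
  by (subst Lnorm_pair_snd[OF HX_measurable]) (auto intro: Lnorm_joint_le)

lemma E1_le:
  assumes "i \<in> I" "k \<in> I" "i \<noteq> k" "1 < p"
  shows "ennreal \<bar>E1 i k\<bar> \<le> Hn p"
  unfolding E1_def
  using Lnorm_mean[OF prob_space_axioms joint_integrable[OF assms(1-3)] assms(4)] Lnorm_joint_le[OF assms(1-3)]
  by (rule order_trans)

text \<open>The second mean enters the coupling as a constant function \<open>v\<close>, whose norm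
  is at most \<open>Hn (2 + \<delta>)\<close>. The product thus acquires the same error
  \<open>err\<close> as a mixed moment.\<close>

lemma E1_mult_sep:
  assumes ik: "i \<in> I" "k \<in> I" "i \<noteq> k" and jl: "j \<in> I" "l \<in> I" "j \<noteq> l"
    and sep: "ereal m \<le> d i k"
  shows "ennreal \<bar>E1 i k * E1 j l\<bar> \<le> 8 * err"
proof -
  let ?u = "\<lambda>z. H (X i (fst z)) (X k (snd z))" and ?v = "\<lambda>z. E1 j l"
  have intMM: "integrable (M \<Otimes>\<^sub>M M) (\<lambda>z. ?u z * ?v z)" using tilde_integrable[OF ik] by simp
  have c: "ennreal \<bar>E1 j l\<bar> \<le> Hn (2 + \<delta>)" by (rule E1_le[OF jl]) (use delta_pos in auto)
  have "ennreal \<bar>(\<integral>\<omega>. ?u (\<omega>, \<omega>) * ?v (\<omega>, \<omega>) \<partial>M) - (\<integral>z. ?u z * ?v z \<partial>(M \<Otimes>\<^sub>M M))\<bar> \<le> 8 * err"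
    by (rule coupling[of "{i}" "{k}", OF _ _ _ _ HX_S_measurable _ _ intMM])
       (use ik sep c joint_integrable[OF ik] Lnorm_joint_le[OF ik] Lnorm_tilde_le[OF ik] delta_pos
         in \<open>auto simp: Lnorm_const prob_space_axioms MM.prob_space_axioms\<close>)
  also have "(\<integral>z. ?u z * ?v z \<partial>(M \<Otimes>\<^sub>M M)) = 0" using integral_tilde_degenerate[OF ik intMM] .
  also have "(\<integral>\<omega>. ?u (\<omega>, \<omega>) * ?v (\<omega>, \<omega>) \<partial>M) = E1 i k * E1 j l" by (simp add: E1_def)
  finally show ?thesis by simp
qed

lemma card3: "card {a, b, c} \<le> 3" and card2: "card {a, b} \<le> 2"
  by (auto simp: card_insert_if)

text \<open>The variable X_i is freed from the other three. Afterwards the first sample point occurs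
  only in H(X_i, X_k), where degeneracy applies. The index \<open>i\<close> may recur as
  \<open>j\<close> or \<open>l\<close>, provided m is at most d(i, i).\<close>

lemma E2_sep:
  assumes ik: "i \<in> I" "k \<in> I" "i \<noteq> k" and jl: "j \<in> I" "l \<in> I" "j \<noteq> l"
    and sep: "ereal m \<le> d i k" "ereal m \<le> d i j" "ereal m \<le> d i l"
  shows "ennreal \<bar>E2 i k j l\<bar> \<le> 8 * err"
proof -
  let ?u = "\<lambda>z. H (X i (fst z)) (X k (snd z))" and ?v = "\<lambda>z. H (X j (snd z)) (X l (snd z))"
  have intMM: "integrable (M \<Otimes>\<^sub>M M) (\<lambda>z. ?u z * ?v z)"
    by (intro integrable_mult_of_squares HX_tilde_measurable tilde_L2 ik
        measurable_compose[OF measurable_snd HX_measurable[OF jl(1,2)]] integrable_pair_snd[OF joint_L2[OF jl]])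
  have "ennreal \<bar>(\<integral>\<omega>. ?u (\<omega>, \<omega>) * ?v (\<omega>, \<omega>) \<partial>M) - (\<integral>z. ?u z * ?v z \<partial>(M \<Otimes>\<^sub>M M))\<bar> \<le> 8 * err"
    by (rule coupling[of "{i}" "{k, j, l}", OF _ _ _ _ HX_S_measurable HX_S_snd_measurable _ intMM])
       (use ik jl sep card3[of k j l] joint_mult_integrable[OF ik jl] Lnorm_joint_le[OF ik] Lnorm_tilde_le[OF ik]
         Lnorm_joint_le[OF jl] Lnorm_joint_snd_le[OF jl] in auto)
  also have "(\<integral>z. ?u z * ?v z \<partial>(M \<Otimes>\<^sub>M M)) = 0"
    by (rule integral_tilde_degenerate[OF ik intMM])
  also have "(\<integral>\<omega>. ?u (\<omega>, \<omega>) * ?v (\<omega>, \<omega>) \<partial>M) = E2 i k j l" by (simp add: E2_def)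
  finally show ?thesis by simp
qed

text \<open>The second moment of H(X_i, X_k) is decoupled in two ways. Using one copy of X_i in both
  factors gives \<open>h i k\<close>; treating the second occurrence of X_i as belonging to the
  other group gives 0. Hence \<open>h i k\<close> is at most the sum of both errors. Since d(i, i) =
  0, this concerns m at most 0.\<close>

lemma h_sep:
  assumes ik: "i \<in> I" "k \<in> I" "i \<noteq> k" and sep: "ereal m \<le> d i k" "ereal m \<le> d i i"
  shows "ennreal \<bar>h i k\<bar> \<le> 16 * err"
proof -
  let ?u = "\<lambda>z. H (X i (fst z)) (X k (snd z))"
  have intMM: "integrable (M \<Otimes>\<^sub>M M) (\<lambda>z. ?u z * ?u z)"
    using tilde_L2[OF ik] by (simp add: power2_eq_square)
  have "ennreal \<bar>(\<integral>\<omega>. ?u (\<omega>, \<omega>) * ?u (\<omega>, \<omega>) \<partial>M) - (\<integral>z. ?u z * ?u z \<partial>(M \<Otimes>\<^sub>M M))\<bar> \<le> 8 * err"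
    by (rule coupling[of "{i}" "{k}", OF _ _ _ _ HX_S_measurable HX_S_measurable _ intMM])
       (use ik sep joint_mult_integrable[OF ik ik] Lnorm_joint_le[OF ik] Lnorm_tilde_le[OF ik] in auto)
  then have "ennreal \<bar>E2 i k i k - h i k\<bar> \<le> 8 * err"
    by (simp add: E2_def h_def power2_eq_square)
  moreover have "ennreal \<bar>E2 i k i k\<bar> \<le> 8 * err"
    by (rule E2_sep[OF ik ik sep(1) sep(2) sep(1)])
  moreover have "ennreal \<bar>h i k\<bar> \<le> ennreal \<bar>E2 i k i k\<bar> + ennreal \<bar>E2 i k i k - h i k\<bar>"
    using ennreal_abs_diff_le[of "E2 i k i k" "E2 i k i k - h i k"] by simp
  ultimately have "ennreal \<bar>h i k\<bar> \<le> 8 * err + 8 * err"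
    using add_mono by (blast intro: order_trans)
  also have "\<dots> = 16 * err" by (simp flip: distrib_right)
  finally show ?thesis .
qed

lemma diag_term_le: "j \<noteq> l \<Longrightarrow> \<bar>diag_term i k j l\<bar> \<le> (if i = j \<or> i = l then \<bar>h i k\<bar> else 0)"
  by (simp add: diag_term_def)

lemma G_abs_le:
  "ennreal \<bar>G i k j l\<bar> \<le> ennreal \<bar>E2 i k j l\<bar> + ennreal \<bar>E1 i k * E1 j l\<bar> + ennreal \<bar>diag_term i k j l\<bar>"
  unfolding G_def by (rule order_trans[OF ennreal_abs_diff_le add_right_mono[OF ennreal_abs_diff_le]])

text \<open>The diagonal term is present only if \<open>i\<close> recurs as \<open>j\<close> or
  \<open>l\<close>; then the separation of \<open>i\<close> from that entry says that m is at most
  d(i, i), and \<open>h_sep\<close> applies.\<close>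

lemma G_singleton:
  assumes ik: "i \<in> I" "k \<in> I" "i \<noteq> k" and jl: "j \<in> I" "l \<in> I" "j \<noteq> l"
    and sep: "ereal m \<le> d i k" "ereal m \<le> d i j" "ereal m \<le> d i l"
  shows "ennreal \<bar>G i k j l\<bar> \<le> 32 * err"
proof -
  have hs: "ennreal \<bar>h i k\<bar> \<le> 16 * err" if "i = j \<or> i = l"
    by (rule h_sep[OF ik sep(1)]) (use that sep in blast)
  have "ennreal \<bar>diag_term i k j l\<bar> \<le> 16 * err"
    using diag_term_le[OF jl(3), of i k] hs by (cases "i = j \<or> i = l") (auto intro: order_trans[OF ennreal_leI])
  then have "ennreal \<bar>G i k j l\<bar> \<le> 8 * err + 8 * err + 16 * err"
    by (rule order_trans[OF G_abs_le add_mono[OF add_mono[OF E2_sep[OF assms] E1_mult_sep[OF ik jl sep(1)]]]])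
  also have "\<dots> = 32 * err" by (simp flip: distrib_right)
  finally show ?thesis .
qed

text \<open>Decoupling the two kernel values gives exactly the product of means subtracted in the
  covariance, so a single coupling error remains.\<close>

lemma G_pair_ik:
  assumes ik: "i \<in> I" "k \<in> I" "i \<noteq> k" and jl: "j \<in> I" "l \<in> I" "j \<noteq> l"
    and con: "d i k \<le> ereal m"
    and sep: "ereal m < d i j" "ereal m < d i l" "ereal m < d k j" "ereal m < d k l"
  shows "ennreal \<bar>G i k j l\<bar> \<le> 32 * err"
proof -
  let ?u = "\<lambda>z. H (X i (fst z)) (X k (fst z))" and ?v = "\<lambda>z. H (X j (snd z)) (X l (snd z))"
  \<comment> \<open>Two distinct indices at distance at most m force m to be at least 1. Separated
    indices are then distinct, and the diagonal term vanishes.\<close>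
  have "(1::ereal) \<le> ereal m" using d_ge_1[OF ik] con by (rule order_trans)
  then have m0: "(0::ereal) \<le> ereal m" by (rule order_trans[rotated]) simp
  have ne: "i \<noteq> j" "i \<noteq> l"
    using leD[OF m0] sep(1,2) d_refl[OF ik(1)] by force+
  have intMM: "integrable (M \<Otimes>\<^sub>M M) (\<lambda>z. ?u z * ?v z)"
    by (intro integrable_mult_of_squares measurable_compose[OF measurable_fst HX_measurable[OF ik(1,2)]]
        measurable_compose[OF measurable_snd HX_measurable[OF jl(1,2)]]
        integrable_pair_fst[OF joint_L2[OF ik]] integrable_pair_snd[OF joint_L2[OF jl]])
  have "ennreal \<bar>(\<integral>\<omega>. ?u (\<omega>, \<omega>) * ?v (\<omega>, \<omega>) \<partial>M) - (\<integral>z. ?u z * ?v z \<partial>(M \<Otimes>\<^sub>M M))\<bar> \<le> 8 * err"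
    by (rule coupling[of "{i, k}" "{j, l}", OF _ _ _ _ HX_S_fst_measurable HX_S_snd_measurable _ intMM])
       (use ik jl sep card2[of i k] card2[of j l] joint_mult_integrable[OF ik jl] Lnorm_joint_le[OF ik] Lnorm_joint_fst_le[OF ik]
         Lnorm_joint_le[OF jl] Lnorm_joint_snd_le[OF jl] in \<open>auto intro: less_imp_le\<close>)
  also have "(\<integral>z. ?u z * ?v z \<partial>(M \<Otimes>\<^sub>M M)) = E1 i k * E1 j l"
    unfolding E1_def
    by (rule integral_pair_fst_snd[OF joint_integrable[OF ik] joint_integrable[OF jl] intMM])
  also have "(\<integral>\<omega>. ?u (\<omega>, \<omega>) * ?v (\<omega>, \<omega>) \<partial>M) = E2 i k j l" by (simp add: E2_def)
  finally have "ennreal \<bar>G i k j l\<bar> \<le> 8 * err" using ne by (simp add: G_def diag_term_def)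
  also have "\<dots> \<le> 32 * err" by (intro mult_right_mono) auto
  finally show ?thesis .
qed

lemma Gamma_bound:
  assumes "i \<in> I" "j \<in> I" "k \<in> I" "l \<in> I" "d i j \<le> ereal m" "k \<noteq> l"
  shows "ennreal \<bar>\<integral>\<omega>. Gamma M (X i) (X j) H (X k \<omega>) (X l \<omega>) \<partial>M\<bar> \<le> gamma_m1 M I d X H m"
  unfolding gamma_m1_def by (rule SUP_upper2[of "(i, j, k, l)"]) (use assms in auto)

text \<open>Both kernels straddle the split. After decoupling, whichever of the two groups contains
  distinct indices is integrated last, which produces the mean of a Gamma; if both groups are
  repetitions, the integral is \<open>h i k\<close> and cancels against the diagonal term.\<close>

lemma G_pair_ij:
  assumes ik: "i \<in> I" "k \<in> I" "i \<noteq> k" and jl: "j \<in> I" "l \<in> I" "j \<noteq> l"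
    and con: "d i j \<le> ereal m" "d k l \<le> ereal m"
    and sep: "ereal m < d i k" "ereal m < d i l" "ereal m < d j k" "ereal m < d j l"
  shows "ennreal \<bar>G i k j l\<bar> \<le> 32 * err + gamma_m1 M I d X H m"
proof -
  let ?u = "\<lambda>z. H (X i (fst z)) (X k (snd z))" and ?v = "\<lambda>z. H (X j (fst z)) (X l (snd z))"
  let ?D = "\<integral>z. ?u z * ?v z \<partial>(M \<Otimes>\<^sub>M M)"
  have m0: "(0::ereal) \<le> ereal m" using d_nonneg[OF ik(1) jl(1)] con(1) by (rule order_trans)
  have ne: "i \<noteq> l" using leD[OF m0] sep(2) d_refl[OF ik(1)] by force
  have intMM: "integrable (M \<Otimes>\<^sub>M M) (\<lambda>z. ?u z * ?v z)"
    by (intro integrable_mult_of_squares HX_tilde_measurable tilde_L2 ik jl)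
  have 1: "ennreal \<bar>(\<integral>\<omega>. ?u (\<omega>, \<omega>) * ?v (\<omega>, \<omega>) \<partial>M) - ?D\<bar> \<le> 8 * err"
    by (rule coupling[of "{i, j}" "{k, l}", OF _ _ _ _ HX_S_measurable HX_S_measurable _ intMM])
       (use ik jl sep card2[of i j] card2[of k l] joint_mult_integrable[OF ik jl] Lnorm_joint_le[OF ik] Lnorm_tilde_le[OF ik]
         Lnorm_joint_le[OF jl] Lnorm_tilde_le[OF jl] in \<open>auto intro: less_imp_le\<close>)
  then have 1: "ennreal \<bar>E2 i k j l - ?D\<bar> \<le> 8 * err" by (simp add: E2_def)
  have int': "integrable (M \<Otimes>\<^sub>M M) (\<lambda>(x, y). H (X i x) (X k y) * H (X j x) (X l y))"
    using intMM by (simp add: split_beta')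
  have 2: "ennreal \<bar>?D - diag_term i k j l\<bar> \<le> gamma_m1 M I d X H m"
  proof -
    consider "k \<noteq> l" | "k = l" "i \<noteq> j" | "k = l" "i = j" by blast
    then show ?thesis
    proof cases
      case 1
      have "?D = (\<integral>(x, y). H (X i x) (X k y) * H (X j x) (X l y) \<partial>(M \<Otimes>\<^sub>M M))" by (simp add: split_beta')
      also have "\<dots> = (\<integral>y. (\<integral>x. H (X i x) (X k y) * H (X j x) (X l y) \<partial>M) \<partial>M)"
        by (rule MM.integral_snd[OF int', symmetric])
      also have "\<dots> = (\<integral>\<omega>. Gamma M (X i) (X j) H (X k \<omega>) (X l \<omega>) \<partial>M)" by (simp add: Gamma_def)
      finally show ?thesis using Gamma_bound[OF ik(1) jl(1) ik(2) jl(2) con(1) 1] 1 ne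
        by (simp add: diag_term_def)
    next
      \<comment> \<open>The supremum defining gamma requires distinct arguments, so the roles are
        exchanged: by symmetry of the kernel, X_k and X_l are integrated out and X_i, X_j become the
        arguments.\<close>
      case 2
      have "?D = (\<integral>(x, y). H (X i x) (X k y) * H (X j x) (X l y) \<partial>(M \<Otimes>\<^sub>M M))" by (simp add: split_beta')
      also have "\<dots> = (\<integral>x. (\<integral>y. H (X i x) (X k y) * H (X j x) (X l y) \<partial>M) \<partial>M)"
        by (rule MM.integral_fst[OF int', symmetric])
      also have "\<dots> = (\<integral>\<omega>. Gamma M (X k) (X l) H (X i \<omega>) (X j \<omega>) \<partial>M)"
        by (simp add: Gamma_def H_sym[of "X k _"] H_sym[of "X l _"])
      finally show ?thesis using Gamma_bound[OF ik(2) jl(2) ik(1) jl(1) con(2) 2(2)] 2 ne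
        by (simp add: diag_term_def)
    next
      case 3
      then have "?D = h i k" by (simp add: h_def power2_eq_square)
      then show ?thesis using 3 ne by (simp add: diag_term_def)
    qed
  qed
  have 3: "ennreal \<bar>E1 i k * E1 j l\<bar> \<le> 8 * err"
    by (rule E1_mult_sep[OF ik jl less_imp_le[OF sep(1)]])
  have "G i k j l = (E2 i k j l - ?D) - E1 i k * E1 j l + (?D - diag_term i k j l)"
    by (simp add: G_def)
  then have "ennreal \<bar>G i k j l\<bar> \<le> ennreal \<bar>E2 i k j l - ?D\<bar> + ennreal \<bar>E1 i k * E1 j l\<bar> + ennreal \<bar>?D - diag_term i k j l\<bar>"
    using order_trans[OF ennreal_abs_add_le add_right_mono[OF ennreal_abs_diff_le],
        of "E2 i k j l - ?D" "E1 i k * E1 j l" "?D - diag_term i k j l"] by (simp only:)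
  also have "\<dots> \<le> 8 * err + 8 * err + gamma_m1 M I d X H m"
    by (intro add_mono 1 2 3)
  also have "\<dots> \<le> 32 * err + gamma_m1 M I d X H m"
    by (intro add_right_mono) (simp flip: distrib_right add: mult_right_mono)
  finally show ?thesis .
qed

lemma square_integral_le_Lnorm:
  assumes "integrable R (\<lambda>x. (f x)\<^sup>2)"
  shows "ennreal (\<integral>x. (f x)\<^sup>2 \<partial>R) \<le> (Lnorm R f 2)\<^sup>2"
proof -
  have "ennreal (\<integral>x. (f x)\<^sup>2 \<partial>R) = (\<integral>\<^sup>+x. ennreal (\<bar>f x\<bar> powr 2) \<partial>R)"
    using assms by (subst nn_integral_eq_integral[symmetric]) (auto simp: powr_2_abs)
  also have "\<dots> = (Lnorm R f 2)\<^sup>2"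
  proof (cases "(\<integral>\<^sup>+x. ennreal (\<bar>f x\<bar> powr 2) \<partial>R) = \<infinity>")
    case True
    then show ?thesis unfolding Lnorm_def enn_rpow_def by (simp add: power2_eq_square ennreal_top_mult)
  next
    case False
    define e where "e = enn2real (\<integral>\<^sup>+x. ennreal (\<bar>f x\<bar> powr 2) \<partial>R)"
    have e: "(\<integral>\<^sup>+x. ennreal (\<bar>f x\<bar> powr 2) \<partial>R) = ennreal e" "0 \<le> e"
      using False by (auto simp: e_def less_top)
    have "(e powr (1 / 2))\<^sup>2 = e" using e(2) by (simp add: powr_half_sqrt)
    then show ?thesis unfolding Lnorm_def enn_rpow_def e(1) using e(2)
      by (simp add: ennreal_power)
  qed
  finally show ?thesis by simp
qed

text \<open>Without any separation, each of the three parts of \<open>G\<close> is bounded by the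
  squared L^2 norm.\<close>

lemma G_any:
  assumes ik: "i \<in> I" "k \<in> I" "i \<noteq> k" and jl: "j \<in> I" "l \<in> I" "j \<noteq> l"
  shows "ennreal \<bar>G i k j l\<bar> \<le> 3 * (Hn 2)\<^sup>2"
proof -
  let ?u = "\<lambda>\<omega>. H (X i \<omega>) (X k \<omega>)" and ?v = "\<lambda>\<omega>. H (X j \<omega>) (X l \<omega>)"
  have sq: "ennreal (\<integral>\<omega>. (?u \<omega>)\<^sup>2 \<partial>M) \<le> (Hn 2)\<^sup>2" "ennreal (\<integral>\<omega>. (?v \<omega>)\<^sup>2 \<partial>M) \<le> (Hn 2)\<^sup>2"
    using square_integral_le_Lnorm[OF joint_L2[OF ik]] square_integral_le_Lnorm[OF joint_L2[OF jl]]
      power_mono[OF Lnorm_joint_le[OF ik, of 2], of 2] power_mono[OF Lnorm_joint_le[OF jl, of 2], of 2]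
    by (auto elim: order_trans)
  have hb: "ennreal (h i k) \<le> (Hn 2)\<^sup>2"
    unfolding h_def using square_integral_le_Lnorm[OF tilde_L2[OF ik]] power_mono[OF Lnorm_tilde_le[OF ik, of 2], of 2]
    by (auto elim: order_trans)
  have h0: "0 \<le> h i k" by (simp add: h_def)
  have "\<bar>E2 i k j l\<bar> \<le> (\<integral>\<omega>. ((?u \<omega>)\<^sup>2 + (?v \<omega>)\<^sup>2) / 2 \<partial>M)"
  proof -
    have "\<bar>E2 i k j l\<bar> \<le> (\<integral>\<omega>. \<bar>?u \<omega> * ?v \<omega>\<bar> \<partial>M)" unfolding E2_def by (rule integral_abs_bound)
    also have "\<dots> \<le> (\<integral>\<omega>. ((?u \<omega>)\<^sup>2 + (?v \<omega>)\<^sup>2) / 2 \<partial>M)"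
    proof (rule integral_mono)
      fix \<omega>
      show "\<bar>?u \<omega> * ?v \<omega>\<bar> \<le> ((?u \<omega>)\<^sup>2 + (?v \<omega>)\<^sup>2) / 2"
        using sum_squares_bound[of "\<bar>?u \<omega>\<bar>" "\<bar>?v \<omega>\<bar>"] by (simp add: abs_mult)
    qed (use joint_mult_integrable[OF ik jl] joint_L2[OF ik] joint_L2[OF jl] in auto)
    finally show ?thesis .
  qed
  also have "\<dots> = ((\<integral>\<omega>. (?u \<omega>)\<^sup>2 \<partial>M) + (\<integral>\<omega>. (?v \<omega>)\<^sup>2 \<partial>M)) / 2"
    using joint_L2[OF ik] joint_L2[OF jl] by simp
  also have "\<dots> \<le> max (\<integral>\<omega>. (?u \<omega>)\<^sup>2 \<partial>M) (\<integral>\<omega>. (?v \<omega>)\<^sup>2 \<partial>M)" by auto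
  finally have "ennreal \<bar>E2 i k j l\<bar> \<le> ennreal (max (\<integral>\<omega>. (?u \<omega>)\<^sup>2 \<partial>M) (\<integral>\<omega>. (?v \<omega>)\<^sup>2 \<partial>M))" by (rule ennreal_leI)
  also have "\<dots> \<le> (Hn 2)\<^sup>2" using sq by (simp add: max_def)
  finally have 1: "ennreal \<bar>E2 i k j l\<bar> \<le> (Hn 2)\<^sup>2" .
  have "ennreal \<bar>E1 i k * E1 j l\<bar> = ennreal \<bar>E1 i k\<bar> * ennreal \<bar>E1 j l\<bar>"
    by (simp add: abs_mult ennreal_mult)
  also have "\<dots> \<le> Hn 2 * Hn 2" by (intro mult_mono E1_le ik jl) auto
  finally have 2: "ennreal \<bar>E1 i k * E1 j l\<bar> \<le> (Hn 2)\<^sup>2" by (simp add: power2_eq_square)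
  have 3: "ennreal \<bar>diag_term i k j l\<bar> \<le> (Hn 2)\<^sup>2"
    using diag_term_le[OF jl(3), of i k] hb h0 by (cases "i = j \<or> i = l") (auto intro: order_trans[OF ennreal_leI])
  have "ennreal \<bar>G i k j l\<bar> \<le> (Hn 2)\<^sup>2 + (Hn 2)\<^sup>2 + (Hn 2)\<^sup>2"
    by (rule order_trans[OF G_abs_le add_mono[OF add_mono[OF 1 2] 3]])
  also have "\<dots> = (1 + 1 + 1) * (Hn 2)\<^sup>2" by (simp only: distrib_right mult_1)
  finally show ?thesis by simp
qed

end

section \<open>Profiles of quadruples\<close>

definition conn_class :: "('i \<Rightarrow> 'i \<Rightarrow> ereal) \<Rightarrow> real \<Rightarrow> 'i list \<Rightarrow> nat \<Rightarrow> nat set" where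
  "conn_class d m xs a = {b. b < length xs \<and> (a, b) \<in> (conn_rel d m xs)\<^sup>*}"

lemma conn_classes_eq: "conn_classes d m xs = conn_class d m xs ` {..<length xs}"
  unfolding conn_classes_def conn_class_def ..

text \<open>A position belongs to its class by reflexivity of the closure, not by a distance: for
  negative m even d(x, x) = 0 exceeds m.\<close>

lemma conn_class_self: "a < length xs \<Longrightarrow> a \<in> conn_class d m xs a"
  by (simp add: conn_class_def)

lemma conn_class_eq:
  assumes sym: "\<And>x y. x \<in> set xs \<Longrightarrow> y \<in> set xs \<Longrightarrow> d x y = d y x" and b: "b \<in> conn_class d m xs a"
  shows "conn_class d m xs b = conn_class d m xs a"
proof -
  have "sym (conn_rel d m xs)"
    unfolding conn_rel_def by (rule symI) (use sym in auto)
  then have "sym ((conn_rel d m xs)\<^sup>*)" by (rule sym_rtrancl)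
  moreover have "(a, b) \<in> (conn_rel d m xs)\<^sup>*" using b by (simp add: conn_class_def)
  ultimately show ?thesis unfolding conn_class_def by (auto dest: symD intro: rtrancl_trans)
qed

lemma conn_class_disjoint:
  assumes sym: "\<And>x y. x \<in> set xs \<Longrightarrow> y \<in> set xs \<Longrightarrow> d x y = d y x"
  shows "disjoint (conn_classes d m xs)"
proof (rule disjointI)
  fix A B assume "A \<in> conn_classes d m xs" "B \<in> conn_classes d m xs" "A \<noteq> B"
  then show "A \<inter> B = {}"
    unfolding conn_classes_eq using conn_class_eq[of xs d _ m, OF sym] by blast
qed

lemma finite_conn_classes: "finite (conn_classes d m xs)"
  by (simp add: conn_classes_def)

lemma sum_profile:
  assumes sym: "\<And>x y. x \<in> set xs \<Longrightarrow> y \<in> set xs \<Longrightarrow> d x y = d y x"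
  shows "sum_mset (profile d m xs) = length xs"
proof -
  have "sum_mset (profile d m xs) = (\<Sum>C\<in>conn_classes d m xs. card C)"
    by (simp add: profile_def sum_unfold_sum_mset)
  also have "\<dots> = card (\<Union>(conn_classes d m xs))"
    by (rule card_Union_disjoint[symmetric])
       (use conn_class_disjoint[of xs d, OF sym] in \<open>auto simp: conn_classes_def\<close>)
  also have "\<Union>(conn_classes d m xs) = {..<length xs}"
    unfolding conn_classes_eq using conn_class_self by (auto simp: conn_class_def)
  finally show ?thesis by simp
qed

lemma in_profile_conn_class:
  assumes "c \<in># profile d m xs"
  obtains a where "a < length xs" "card (conn_class d m xs a) = c"
  using assms finite_conn_classes[of d m xs] unfolding profile_def by (auto simp: conn_classes_eq)

lemma zero_notin_profile: "0 \<notin># profile d m xs"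
proof
  assume "0 \<in># profile d m xs"
  then obtain a where "a < length xs" "card (conn_class d m xs a) = 0" by (rule in_profile_conn_class)
  then show False using conn_class_self[of a xs d m] by (auto simp: conn_class_def)
qed

text \<open>These are the partitions of 4, obtained by removing one part and using the partitions of
  0, 1, 2 and 3.\<close>

lemma mset_sum_4_cases:
  fixes p :: "nat multiset"
  assumes "sum_mset p = 4" "0 \<notin># p"
  shows "p \<in> {mset [4], mset [3, 1], mset [2, 2], mset [2, 1, 1], mset [1, 1, 1, 1]}"
proof -
  have split: "\<exists>x r. q = add_mset x r \<and> 0 < x \<and> x + sum_mset r = n \<and> 0 \<notin># r"
    if "sum_mset q = n" "0 \<notin># q" "0 < n" for q :: "nat multiset" and n
    using that by (cases q) auto
  have s0: "q = {#}" if "sum_mset q = 0" "0 \<notin># q" for q :: "nat multiset"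
    using that by (cases q) auto
  have s1: "q = {#1#}" if q: "sum_mset q = 1" "0 \<notin># q" for q :: "nat multiset"
  proof -
    obtain x r where r: "q = add_mset x r" "0 < x" "x + sum_mset r = 1" "0 \<notin># r"
      using split[OF q] by auto
    then have "x = 1" "sum_mset r = 0" by linarith+
    then show ?thesis using s0[OF _ r(4)] r(1) by blast
  qed
  have s2: "q = {#2#} \<or> q = {#1, 1#}" if q: "sum_mset q = 2" "0 \<notin># q" for q :: "nat multiset"
  proof -
    obtain x r where r: "q = add_mset x r" "0 < x" "x + sum_mset r = 2" "0 \<notin># r"
      using split[OF q] by auto
    then consider "x = 2" "sum_mset r = 0" | "x = 1" "sum_mset r = 1" by linarith
    then show ?thesis using s0[OF _ r(4)] s1[OF _ r(4)] r(1) by cases auto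
  qed
  have s3: "q = {#3#} \<or> q = {#2, 1#} \<or> q = {#1, 1, 1#}" if q: "sum_mset q = 3" "0 \<notin># q" for q :: "nat multiset"
  proof -
    obtain x r where r: "q = add_mset x r" "0 < x" "x + sum_mset r = 3" "0 \<notin># r"
      using split[OF q] by auto
    then consider "x = 3" "sum_mset r = 0" | "x = 2" "sum_mset r = 1" | "x = 1" "sum_mset r = 2" by linarith
    then show ?thesis
      using s0[OF _ r(4)] s1[OF _ r(4)] s2[OF _ r(4)] r(1) by cases (auto simp: add_mset_commute)
  qed
  obtain x r where r: "p = add_mset x r" "0 < x" "x + sum_mset r = 4" "0 \<notin># r"
    using split[OF assms] by auto
  then consider "x = 4" "sum_mset r = 0" | "x = 3" "sum_mset r = 1" | "x = 2" "sum_mset r = 2" | "x = 1" "sum_mset r = 3"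
    by linarith
  then show ?thesis
    using s0[OF _ r(4)] s1[OF _ r(4)] s2[OF _ r(4)] s3[OF _ r(4)] r(1) by cases (auto simp: add_mset_commute)
qed

lemma not_conn_imp_far:
  assumes "a < length xs" "b < length xs" "b \<notin> conn_class d m xs a"
  shows "ereal m < d (xs ! a) (xs ! b)"
proof (rule ccontr)
  assume "\<not> ereal m < d (xs ! a) (xs ! b)"
  then have "(a, b) \<in> conn_rel d m xs" using assms by (simp add: conn_rel_def not_less)
  then show False using assms by (auto simp: conn_class_def)
qed

text \<open>Connection is defined by chains, but a class of only two positions leaves no room for an
  intermediate one, so its members are close directly.\<close>

lemma pair_class_close:
  assumes C: "conn_class d m xs a = {a, b}" and ab: "a \<noteq> b"
  shows "d (xs ! a) (xs ! b) \<le> ereal m"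
proof (rule ccontr)
  assume far: "\<not> d (xs ! a) (xs ! b) \<le> ereal m"
  have "c = a" if "(a, c) \<in> (conn_rel d m xs)\<^sup>*" for c
    using that
  proof induction
    case (step y z)
    \<comment> \<open>If the direct step from \<open>a\<close> to \<open>b\<close> is too long, a
      chain that is still at \<open>a\<close> can only stay there.\<close>
    then have yz: "(a, z) \<in> conn_rel d m xs" by simp
    then have "z \<in> conn_class d m xs a" by (auto simp: conn_class_def conn_rel_def)
    then show ?case using yz far C by (auto simp: conn_rel_def)
  qed simp
  moreover have "(a, b) \<in> (conn_rel d m xs)\<^sup>*" using C by (auto simp: conn_class_def)
  ultimately show False using ab by blast
qed

lemma profile_const_list:
  assumes "d i i = 0"
  shows "profile d m (replicate 4 i) = (if 0 \<le> m then mset [4] else mset [1, 1, 1, 1])"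
proof (cases "0 \<le> m")
  case True
  have "conn_rel d m (replicate 4 i) = {..<4} \<times> {..<4}"
    using True assms by (auto simp: conn_rel_def zero_ereal_def)
  then have "conn_class d m (replicate 4 i) a = {..<4}" if "a < 4" for a
    using that unfolding conn_class_def by auto
  then have "conn_classes d m (replicate 4 i) = {{..<4}}"
    unfolding conn_classes_eq by (force simp: image_iff)
  then show ?thesis using True by (simp add: profile_def)
next
  case False
  have "conn_rel d m (replicate 4 i) = {}"
    using False assms by (auto simp: conn_rel_def zero_ereal_def)
  then have "conn_class d m (replicate 4 i) a = {a}" if "a < 4" for a
    using that unfolding conn_class_def by auto
  then have "conn_classes d m (replicate 4 i) = (\<lambda>a. {a}) ` {0, 1, 2, 3}"
    unfolding conn_classes_eq by (intro image_cong) auto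
  then show ?thesis using False by (simp add: profile_def)
qed

lemma sum_indicator_tau:
  fixes c :: ennreal
  assumes "finite I" "sum_list qs = q"
  shows "(\<Sum>xs\<in>{xs. length xs = q \<and> set xs \<subseteq> I}. if profile d m xs = mset qs then c else 0)
    = of_nat (tau I d m qs) * c"
proof -
  have fin: "finite {xs. length xs = q \<and> set xs \<subseteq> I}"
    using finite_lists_length_eq[OF assms(1), of q] by (simp add: conj_commute)
  have "(\<Sum>xs\<in>{xs. length xs = q \<and> set xs \<subseteq> I}. if profile d m xs = mset qs then c else 0)
      = (\<Sum>xs\<in>{xs. length xs = q \<and> set xs \<subseteq> I} \<inter> {xs. profile d m xs = mset qs}. c)"
    using fin by (subst sum.inter_restrict) auto
  also have "{xs. length xs = q \<and> set xs \<subseteq> I} \<inter> {xs. profile d m xs = mset qs}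
      = {xs. length xs = sum_list qs \<and> set xs \<subseteq> I \<and> profile d m xs = mset qs}" using assms by auto
  finally show ?thesis by (simp add: tau_def)
qed

section \<open>Square integrability under the joint law\<close>

context mixing_ustat
begin

lemma tau_pos:
  assumes i: "i \<in> I" and p: "profile d m (replicate 4 i) = mset qs" and q: "sum_list qs = 4"
  shows "0 < tau I d m qs"
proof -
  have "finite {xs. set xs \<subseteq> I \<and> length xs = sum_list qs}" by (rule finite_lists_length_eq[OF finI])
  then have "finite {xs. length xs = sum_list qs \<and> set xs \<subseteq> I \<and> profile d m xs = mset qs}"
    by (rule rev_finite_subset) auto
  moreover have "replicate 4 i \<in> {xs. length xs = sum_list qs \<and> set xs \<subseteq> I \<and> profile d m xs = mset qs}"
    using i p q by auto
  ultimately show ?thesis unfolding tau_def card_gt_0_iff by blast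
qed

text \<open>The left side of the smallness hypothesis for one fixed \<open>n\<close>, with the
  mixing term abbreviated by \<open>err\<close>.\<close>

definition ratio_bound :: ennreal where
  "ratio_bound = of_nat (tau I d m [4]) * (Hn 2)\<^sup>2
    + (of_nat (tau I d m [3,1] + tau I d m [2,1,1] + tau I d m [1,1,1,1]) + of_nat (tau I d m [2,2])) * err
    + of_nat (tau I d m [2,2]) * gamma_m1 M I d X H m"

text \<open>Two empty groups are at infinite distance, so the mixing condition applies to them and
  bounds a nonnegative coefficient by \<open>\<beta>\<close>.\<close>

lemma beta_nonneg: "0 \<le> \<beta>"
  using beta_coef_S[of "{}" "{}"] by auto

lemma integrable_of_moment:
  assumes ik: "i \<in> I" "k \<in> I" "i \<noteq> k" and p: "2 \<le> p" and fin: "Hn p \<noteq> \<infinity>"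
  shows "integrable M (\<lambda>\<omega>. (H (X i \<omega>) (X k \<omega>))\<^sup>2)"
proof -
  let ?f = "\<lambda>\<omega>. H (X i \<omega>) (X k \<omega>)"
  note [measurable] = HX_measurable[OF ik(1,2)]
  have "Lnorm M ?f p \<le> ennreal (enn2real (Hn p))"
    using Lnorm_joint_le[OF ik, of p] fin by (simp add: less_top)
  then have "(\<integral>\<^sup>+\<omega>. ennreal (\<bar>?f \<omega>\<bar> powr p) \<partial>M) \<le> ennreal (enn2real (Hn p) powr p)"
    by (rule nn_integral_le_of_Lnorm) (use p in auto)
  then have ip: "integrable M (\<lambda>\<omega>. \<bar>?f \<omega>\<bar> powr p)"
    by (intro integrableI_nonneg) (auto intro: order.strict_trans1)
  have bd: "x\<^sup>2 \<le> 1 + \<bar>x\<bar> powr p" for x :: real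
  proof (cases "\<bar>x\<bar> \<le> 1")
    case True
    then have "x\<^sup>2 \<le> 1" by (simp add: abs_square_le_1)
    then show ?thesis by (smt (verit) powr_ge_zero)
  next
    case False
    then have "\<bar>x\<bar> powr 2 \<le> \<bar>x\<bar> powr p" using p by (intro powr_mono) auto
    then show ?thesis unfolding powr_2_abs by simp
  qed
  show ?thesis
    by (rule Bochner_Integration.integrable_bound[of _ "\<lambda>\<omega>. 1 + \<bar>?f \<omega>\<bar> powr p"]) (use ip bd in auto)
qed

text \<open>
  A finite \<open>ratio_bound\<close> does not make every norm in it finite, since \<open>0 * \<infinity> = 0\<close>. For
  \<open>m \<ge> 0\<close> a constant quadruple has profile (4), so the coefficient of \<open>Hn 2\<close> is positive. For
  \<open>m < 0\<close> not even equal entries are connected, and the constant quadruple has profile (1,1,1,1);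
  then either \<open>Hn (2 + \<delta>)\<close> is finite, or \<open>\<beta> = 0\<close> and the joint and product laws coincide.
\<close>
lemma joint_L2_of_ratio_bound:
  assumes fin: "ratio_bound \<noteq> \<infinity>" and ik: "i \<in> I" "k \<in> I" "i \<noteq> k"
  shows "integrable M (\<lambda>\<omega>. (H (X i \<omega>) (X k \<omega>))\<^sup>2)"
proof (cases "0 \<le> m")
  case True
  have "0 < tau I d m [4]"
    by (rule tau_pos[OF ik(1)]) (use profile_const_list[of d i m, OF d_refl[OF ik(1)]] True in auto)
  then have "Hn 2 \<noteq> \<infinity>"
    using fin unfolding ratio_bound_def by (auto simp: power2_eq_square ennreal_mult_top ennreal_top_mult)
  then show ?thesis by (intro integrable_of_moment[OF ik, of 2]) auto
next
  case False
  have t: "0 < tau I d m [1,1,1,1]"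
    by (rule tau_pos[OF ik(1)]) (use profile_const_list[of d i m, OF d_refl[OF ik(1)]] False in auto)
  have e: "err \<noteq> \<infinity>"
  proof
    assume "err = \<infinity>"
    then have "(of_nat (tau I d m [3,1] + tau I d m [2,1,1] + tau I d m [1,1,1,1]) + of_nat (tau I d m [2,2])) * err = \<infinity>"
      using t by (simp add: ennreal_mult_top)
    then show False using fin unfolding ratio_bound_def by simp
  qed
  show ?thesis
  proof (cases "\<beta> = 0")
    case True
    \<comment> \<open>For negative m all pairs of indices count as separated.\<close>
    have "ereal m \<le> d i k"
      using d_nonneg[OF ik(1,2)] False by (auto intro: order_trans[of _ 0])
    then have "joint_moment M (X i) (X k) H 2 < \<infinity>"
      using joint_moment_eq_tilde_moment[OF ik(1,2) _ True] H_L2[OF ik] by simp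
    then show ?thesis using HX_measurable[OF ik(1,2)] unfolding joint_moment_def
      by (intro integrableI_nonneg) (auto simp: powr_2_abs)
  next
    case False
    then have "0 < \<beta> powr (\<delta> / (2 + \<delta>))" using beta_nonneg by simp
    then have "Hn (2 + \<delta>) \<noteq> \<infinity>"
      using e unfolding err_def by (auto simp: power2_eq_square ennreal_mult_top ennreal_top_mult)
    then show ?thesis by (rule integrable_of_moment[OF ik, rotated]) (use delta_pos in auto)
  qed
qed

end

section \<open>The variance\<close>

context mixing_ustat_L2
begin

text \<open>The symmetries of \<open>G\<close> bring the isolated position to the front, where the
  singleton estimate is stated.\<close>

lemma G_bound_singleton_class:
  assumes ik: "i \<in> I" "k \<in> I" "i \<noteq> k" and jl: "j \<in> I" "l \<in> I" "j \<noteq> l"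
    and one: "1 \<in># profile d m [i, k, j, l]"
  shows "ennreal \<bar>G i k j l\<bar> \<le> 32 * err"
proof -
  let ?xs = "[i, k, j, l]"
  obtain a where a: "a < length ?xs" "card (conn_class d m ?xs a) = 1"
    using one by (rule in_profile_conn_class)
  have C: "conn_class d m ?xs a = {a}"
    using a(2) conn_class_self[OF a(1), of d m] by (metis card_1_singletonE singletonD)
  have far: "ereal m \<le> d (?xs ! a) (?xs ! b)" if "b < 4" "b \<noteq> a" for b
    by (rule less_imp_le, rule not_conn_imp_far[OF a(1)]) (use that C in auto)
  consider "a = 0" | "a = 1" | "a = 2" | "a = 3" using a(1) by force
  then show ?thesis
  proof cases
    case 1
    show ?thesis
      by (rule G_singleton[OF ik jl]) (use far[of 1] far[of 2] far[of 3] 1 in auto)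
  next
    case 2
    have "ennreal \<bar>G k i j l\<bar> \<le> 32 * err"
      by (rule G_singleton[OF ik(2,1) ik(3)[symmetric] jl]) (use far[of 0] far[of 2] far[of 3] 2 in auto)
    then show ?thesis using G_swap_left[OF ik(1,2)] by simp
  next
    case 3
    have "ennreal \<bar>G j l i k\<bar> \<le> 32 * err"
      by (rule G_singleton[OF jl ik]) (use far[of 3] far[of 0] far[of 1] 3 in auto)
    then show ?thesis using G_swap_pairs[OF ik(1,2)] by simp
  next
    case 4
    have "ennreal \<bar>G l j i k\<bar> \<le> 32 * err"
      by (rule G_singleton[OF jl(2,1) jl(3)[symmetric] ik]) (use far[of 2] far[of 0] far[of 1] 4 in auto)
    moreover have "G l j i k = G i k j l"
      using G_swap_left[OF jl(1,2), of i k] G_swap_pairs[OF ik(1,2), of j l] by (rule trans)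
    ultimately show ?thesis by simp
  qed
qed

text \<open>Everything depends on the partner \<open>b\<close> of position 0. Partner 1 means that
  the classes are the two kernel pairs; partners 2 and 3 are the crossed pairings, interchanged by
  swapping \<open>j\<close> and \<open>l\<close>.\<close>

lemma G_bound_two_pairs:
  assumes ik: "i \<in> I" "k \<in> I" "i \<noteq> k" and jl: "j \<in> I" "l \<in> I" "j \<noteq> l"
    and two: "profile d m [i, k, j, l] = mset [2, 2]"
  shows "ennreal \<bar>G i k j l\<bar> \<le> 32 * err + gamma_m1 M I d X H m"
proof -
  let ?xs = "[i, k, j, l]"
  define C where "C = conn_class d m ?xs"
  have Csub: "C a \<subseteq> {0, 1, 2, 3}" for a unfolding C_def conn_class_def by auto
  have Cself: "a \<in> C a" if "a < 4" for a
    unfolding C_def by (rule conn_class_self) (use that in simp)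
  have Ccard: "card (C a) = 2" if "a < 4" for a
  proof -
    have "C a \<in> conn_classes d m ?xs" unfolding C_def conn_classes_eq using that by auto
    then have "card (C a) \<in># profile d m ?xs"
      unfolding profile_def using finite_conn_classes[of d m ?xs] by simp
    then show ?thesis unfolding two by auto
  qed
  have Ceq: "C b = C a" if "b \<in> C a" for a b
    unfolding C_def
    by (rule conn_class_eq) (use that ik jl in \<open>auto simp: C_def intro: d_sym\<close>)
  have far: "ereal m < d (?xs ! a) (?xs ! b)" if "a < 4" "b < 4" "b \<notin> C a" for a b
    by (rule not_conn_imp_far) (use that in \<open>auto simp: C_def\<close>)
  have close: "d (?xs ! a) (?xs ! b) \<le> ereal m" if "C a = {a, b}" "a \<noteq> b" for a b
    by (rule pair_class_close) (use that in \<open>auto simp: C_def\<close>)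
  obtain b where b: "C 0 = {0, b}" "b \<noteq> 0"
  proof -
    obtain x y where "C 0 = {x, y}" "x \<noteq> y" using Ccard[of 0] by (auto simp: card_2_iff)
    moreover have "0 \<in> C 0" using Cself[of 0] by simp
    ultimately show thesis by (cases "x = 0") (use that[of y] that[of x] in auto)
  qed
  have Cb: "C b = {0, b}" using Ceq[of b 0] b by simp
  have b4: "b \<in> {1, 2, 3}" using Csub[of 0] b by auto
  \<comment> \<open>The class of \<open>c\<close> avoids 0 and \<open>b\<close> and has two
    elements, hence it is the whole complement of the first class.\<close>
  have rest: "C c = {0, 1, 2, 3} - {0, b}" if c: "c < 4" "c \<noteq> 0" "c \<noteq> b" for c
  proof (rule card_subset_eq)
    have "c \<in> C c" by (rule Cself[OF c(1)])
    then have "C c \<noteq> {0, b}" using c by auto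
    then have "0 \<notin> C c" "b \<notin> C c" using Ceq[of 0 c] Ceq[of b c] b(1) Cb by argo+
    then show "C c \<subseteq> {0, 1, 2, 3} - {0, b}" using Csub[of c] by auto
    show "card (C c) = card ({0, 1, 2, 3} - {0, b})" using Ccard[OF c(1)] b4 by auto
  qed simp
  have F01: "1 \<notin> C 0 \<Longrightarrow> ereal m < d i k"
    and F02: "2 \<notin> C 0 \<Longrightarrow> ereal m < d i j"
    and F03: "3 \<notin> C 0 \<Longrightarrow> ereal m < d i l"
    and F12: "2 \<notin> C 1 \<Longrightarrow> ereal m < d k j"
    and F13: "3 \<notin> C 1 \<Longrightarrow> ereal m < d k l"
    and F21: "1 \<notin> C 2 \<Longrightarrow> ereal m < d j k"
    and F23: "3 \<notin> C 2 \<Longrightarrow> ereal m < d j l"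
    and F31: "1 \<notin> C 3 \<Longrightarrow> ereal m < d l k"
    and F32: "2 \<notin> C 3 \<Longrightarrow> ereal m < d l j"
    using far[of 0 1] far[of 0 2] far[of 0 3] far[of 1 2] far[of 1 3] far[of 2 1] far[of 2 3] far[of 3 1] far[of 3 2] by simp_all
  have K01: "C 0 = {0, 1} \<Longrightarrow> d i k \<le> ereal m"
    and K02: "C 0 = {0, 2} \<Longrightarrow> d i j \<le> ereal m"
    and K03: "C 0 = {0, 3} \<Longrightarrow> d i l \<le> ereal m"
    and K12: "C 1 = {1, 2} \<Longrightarrow> d k j \<le> ereal m"
    and K13: "C 1 = {1, 3} \<Longrightarrow> d k l \<le> ereal m"
    using close[of 0 1] close[of 0 2] close[of 0 3] close[of 1 2] close[of 1 3] by simp_all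
  from b4 consider "b = 1" | "b = 2" | "b = 3" by blast
  then show ?thesis
  proof cases
    case 1
    have C01: "C 0 = {0, 1}" "C 1 = {0, 1}" using b(1) Cb unfolding 1 by simp_all
    have "ennreal \<bar>G i k j l\<bar> \<le> 32 * err"
      by (rule G_pair_ik[OF ik jl K01[OF C01(1)] F02 F03 F12 F13]) (simp_all only: C01, simp_all)
    then show ?thesis by (rule order_trans) simp
  next
    case 2
    have C01: "C 0 = {0, 2}" "C 2 = {0, 2}" using b(1) Cb unfolding 2 by simp_all
    have "C 1 = {0, 1, 2, 3} - {0, 2}" using rest[of 1, unfolded 2] by simp
    also have "\<dots> = {1, 3}" by auto
    finally have C1: "C 1 = {1, 3}" .
    show ?thesis
      by (rule G_pair_ij[OF ik jl K02[OF C01(1)] K13[OF C1] F01 F03 F21 F23]) (simp_all only: C01, simp_all)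
  next
    case 3
    have C01: "C 0 = {0, 3}" "C 3 = {0, 3}" using b(1) Cb unfolding 3 by simp_all
    have "C 1 = {0, 1, 2, 3} - {0, 3}" using rest[of 1, unfolded 3] by simp
    also have "\<dots> = {1, 2}" by auto
    finally have C1: "C 1 = {1, 2}" .
    have "ennreal \<bar>G i k l j\<bar> \<le> 32 * err + gamma_m1 M I d X H m"
      by (rule G_pair_ij[OF ik jl(2,1) jl(3)[symmetric] K03[OF C01(1)] K12[OF C1] F01 F02 F31 F32])
         (simp_all only: C01, simp_all)
    then show ?thesis unfolding G_swap_right[OF ik(1,2) jl(1,2)] .
  qed
qed

text \<open>A sum of indicators instead of a case distinction: summed over all quadruples, each
  summand turns into a \<open>tau\<close> times a constant. The coefficients are raised to 32
  throughout so that the total is a multiple of \<open>ratio_bound\<close>.\<close>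

definition profile_bound :: "nat multiset \<Rightarrow> ennreal" where
  "profile_bound p = (if p = mset [4] then 32 * (Hn 2)\<^sup>2 else 0)
    + (if p = mset [3, 1] then 32 * err else 0)
    + (if p = mset [2, 1, 1] then 32 * err else 0)
    + (if p = mset [1, 1, 1, 1] then 32 * err else 0)
    + (if p = mset [2, 2] then 32 * err + 32 * gamma_m1 M I d X H m else 0)"

lemma G_bound:
  assumes ik: "i \<in> I" "k \<in> I" "i \<noteq> k" and jl: "j \<in> I" "l \<in> I" "j \<noteq> l"
  shows "ennreal \<bar>G i k j l\<bar> \<le> profile_bound (profile d m [i, k, j, l])"
proof -
  let ?p = "profile d m [i, k, j, l]"
  have "sum_mset ?p = length [i, k, j, l]"
    by (rule sum_profile) (use ik jl d_sym in auto)
  then have "sum_mset ?p = 4" by simp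
  from mset_sum_4_cases[OF this zero_notin_profile]
  consider "?p = mset [4]" | "?p = mset [3, 1]" | "?p = mset [2, 1, 1]" | "?p = mset [1, 1, 1, 1]" | "?p = mset [2, 2]"
    unfolding insert_iff empty_iff by blast
  then show ?thesis
  proof cases
    case 1
    have "ennreal \<bar>G i k j l\<bar> \<le> 3 * (Hn 2)\<^sup>2" by (rule G_any[OF ik jl])
    also have "\<dots> \<le> 32 * (Hn 2)\<^sup>2" by (rule mult_right_mono) auto
    finally show ?thesis by (simp add: profile_bound_def 1)
  next
    case 5
    have "ennreal \<bar>G i k j l\<bar> \<le> 32 * err + gamma_m1 M I d X H m" by (rule G_bound_two_pairs[OF ik jl 5])
    also have "\<dots> \<le> 32 * err + 32 * gamma_m1 M I d X H m"
      using mult_right_mono[of 1 "32::ennreal" "gamma_m1 M I d X H m"] by (intro add_left_mono) simp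
    also have "\<dots> \<le> profile_bound ?p"
      unfolding profile_bound_def 5 by (rule add_increasing) simp_all
    finally show ?thesis .
  next
    case 2
    then have "1 \<in># ?p" by simp
    from G_bound_singleton_class[OF ik jl this] show ?thesis
      by (simp add: profile_bound_def 2 add_increasing2)
  next
    case 3
    then have "1 \<in># ?p" by simp
    from G_bound_singleton_class[OF ik jl this] show ?thesis
      by (simp add: profile_bound_def 3 add_increasing2)
  next
    case 4
    then have "1 \<in># ?p" by simp
    from G_bound_singleton_class[OF ik jl this] show ?thesis
      by (simp add: profile_bound_def 4 add_increasing2)
  qed
qed

lemma sum_profile_bound:
  "(\<Sum>xs\<in>{xs. length xs = 4 \<and> set xs \<subseteq> I}. profile_bound (profile d m xs)) = 32 * ratio_bound"
  unfolding profile_bound_def sum.distrib ratio_bound_def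
  by (simp only: sum_indicator_tau[OF finI] sum_list.Cons sum_list.Nil)
     (simp add: sum_indicator_tau[OF finI] distrib_left distrib_right mult_ac add_ac)

section \<open>Summation over all quadruples\<close>

definition pairs :: "('i \<times> 'i) set" where
  "pairs = {(i, k). i \<in> I \<and> k \<in> I \<and> i \<noteq> k}"

lemma finite_pairs: "finite pairs"
  by (rule finite_subset[of _ "I \<times> I"]) (use finI in \<open>auto simp: pairs_def\<close>)

lemma sum_G_le: "(\<Sum>(i, k)\<in>pairs. \<Sum>(j, l)\<in>pairs. ennreal \<bar>G i k j l\<bar>) \<le> 32 * ratio_bound"
proof -
  let ?T = "{xs. length xs = 4 \<and> set xs \<subseteq> I}"
  let ?f = "\<lambda>((i, k), (j, l)). [i, k, j, l]"
  have finT: "finite ?T" using finite_lists_length_eq[OF finI, of 4] by (simp add: conj_commute)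
  have "(\<Sum>(i, k)\<in>pairs. \<Sum>(j, l)\<in>pairs. ennreal \<bar>G i k j l\<bar>)
      = (\<Sum>((i, k), (j, l))\<in>pairs \<times> pairs. ennreal \<bar>G i k j l\<bar>)"
    by (simp add: sum.cartesian_product split_beta)
  also have "\<dots> \<le> (\<Sum>x\<in>pairs \<times> pairs. profile_bound (profile d m (?f x)))"
    by (rule sum_mono) (use G_bound in \<open>auto simp: pairs_def\<close>)
  also have "\<dots> = (\<Sum>xs\<in>?f ` (pairs \<times> pairs). profile_bound (profile d m xs))"
    by (subst sum.reindex) (auto intro!: inj_onI)
  \<comment> \<open>Only quadruples with i different from k and j different from l occur in the
    variance, whereas \<open>tau\<close> counts all lists of length 4; adding the rest is harmless
    since the bound is nonnegative.\<close>
  also have "\<dots> \<le> (\<Sum>xs\<in>?T. profile_bound (profile d m xs))"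
    by (rule sum_mono2[OF finT]) (auto simp: pairs_def)
  also have "\<dots> = 32 * ratio_bound" by (rule sum_profile_bound)
  finally show ?thesis .
qed

lemma sum_diag_term: "(\<Sum>(i, k)\<in>pairs. \<Sum>(j, l)\<in>pairs. diag_term i k j l) = 2 * sigma2 M I X H"
proof -
  have "(\<Sum>(j, l)\<in>pairs. diag_term i k j l) = 2 * h i k" if ik: "(i, k) \<in> pairs" for i k
  proof -
    \<comment> \<open>The set \<open>pairs\<close> is closed under reversal, so both (i, k) and (k,
      i) are met, and each contributes \<open>h i k\<close>.\<close>
    have "(\<Sum>(j, l)\<in>pairs. diag_term i k j l)
        = (\<Sum>q\<in>pairs. (if (i, k) = q then h i k else 0) + (if (k, i) = q then h i k else 0))"
    proof (rule sum.cong[OF refl])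
      fix q :: "'i \<times> 'i"
      obtain j l where q: "q = (j, l)" by (cases q)
      have "(i = l \<and> k = j) = ((k, i) = q)" "(i = j \<and> k = l) = ((i, k) = q)" unfolding q by auto
      then show "(case q of (j, l) \<Rightarrow> diag_term i k j l)
          = (if (i, k) = q then h i k else 0) + (if (k, i) = q then h i k else 0)"
        by (simp add: diag_term_def q)
    qed
    also have "\<dots> = 2 * h i k"
      using ik finite_pairs by (simp add: sum.distrib) (auto simp: pairs_def)
    finally show ?thesis .
  qed
  then have "(\<Sum>(i, k)\<in>pairs. \<Sum>(j, l)\<in>pairs. diag_term i k j l) = (\<Sum>(i, k)\<in>pairs. 2 * h i k)"
    by (intro sum.cong) auto
  then show ?thesis unfolding sigma2_eq pairs_def[symmetric] by (simp add: sum_distrib_left split_beta)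
qed

lemma ennreal_abs_sum_le: "ennreal \<bar>\<Sum>x\<in>A. f x\<bar> \<le> (\<Sum>x\<in>A. ennreal \<bar>f x\<bar>)"
proof -
  have "ennreal \<bar>\<Sum>x\<in>A. f x\<bar> \<le> ennreal (\<Sum>x\<in>A. \<bar>f x\<bar>)" by (rule ennreal_leI[OF sum_abs])
  also have "\<dots> = (\<Sum>x\<in>A. ennreal \<bar>f x\<bar>)" by (rule sum_ennreal[symmetric]) simp
  finally show ?thesis .
qed

lemma Ustat_eq: "Ustat I X H \<omega> = (\<Sum>(i, k)\<in>pairs. H (X i \<omega>) (X k \<omega>))"
  unfolding Ustat_def pairs_def by (simp add: split_beta)

lemma Ustat_square_eq:
  "(Ustat I X H \<omega>)\<^sup>2 = (\<Sum>p\<in>pairs. \<Sum>q\<in>pairs.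
    H (X (fst p) \<omega>) (X (snd p) \<omega>) * H (X (fst q) \<omega>) (X (snd q) \<omega>))"
  unfolding Ustat_eq power2_eq_square sum_product by (simp add: split_beta)

lemma Ustat_square_integrable: "integrable M (\<lambda>\<omega>. (Ustat I X H \<omega>)\<^sup>2)"
  unfolding Ustat_square_eq
  by (intro Bochner_Integration.integrable_sum joint_mult_integrable) (auto simp: pairs_def)

lemma variance_Ustat:
  "variance (Ustat I X H) = (\<Sum>(i, k)\<in>pairs. \<Sum>(j, l)\<in>pairs. E2 i k j l - E1 i k * E1 j l)"
proof -
  have int1: "integrable M (Ustat I X H)"
    unfolding Ustat_eq[abs_def] split_beta
    by (intro Bochner_Integration.integrable_sum joint_integrable) (auto simp: pairs_def)
  have e1: "expectation (Ustat I X H) = (\<Sum>p\<in>pairs. E1 (fst p) (snd p))"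
    unfolding Ustat_eq[abs_def] split_beta E1_def
    by (intro Bochner_Integration.integral_sum joint_integrable) (auto simp: pairs_def)
  have "expectation (\<lambda>\<omega>. (Ustat I X H \<omega>)\<^sup>2)
      = (\<Sum>p\<in>pairs. expectation (\<lambda>\<omega>. \<Sum>q\<in>pairs. H (X (fst p) \<omega>) (X (snd p) \<omega>) * H (X (fst q) \<omega>) (X (snd q) \<omega>)))"
    unfolding Ustat_square_eq
    by (intro Bochner_Integration.integral_sum Bochner_Integration.integrable_sum joint_mult_integrable)
       (auto simp: pairs_def)
  also have "\<dots> = (\<Sum>p\<in>pairs. \<Sum>q\<in>pairs. E2 (fst p) (snd p) (fst q) (snd q))"
    unfolding E2_def
    by (intro sum.cong refl Bochner_Integration.integral_sum joint_mult_integrable) (auto simp: pairs_def)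
  finally have e2: "expectation (\<lambda>\<omega>. (Ustat I X H \<omega>)\<^sup>2) = \<dots>" .
  have "variance (Ustat I X H) = expectation (\<lambda>\<omega>. (Ustat I X H \<omega>)\<^sup>2) - (expectation (Ustat I X H))\<^sup>2"
    by (rule variance_eq[OF int1 Ustat_square_integrable])
  then show ?thesis unfolding e1 e2 by (simp add: power2_eq_square sum_product sum_subtractf split_beta)
qed

text \<open>The difference is exactly the sum of all \<open>G\<close>, because the diagonal terms
  sum to the subtracted \<open>2 * sigma2 M I X H\<close>.\<close>

lemma variance_Ustat_bound:
  "ennreal \<bar>variance (Ustat I X H) - 2 * sigma2 M I X H\<bar> \<le> 32 * ratio_bound"
proof -
  have "variance (Ustat I X H) - 2 * sigma2 M I X H = (\<Sum>(i, k)\<in>pairs. \<Sum>(j, l)\<in>pairs. G i k j l)"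
    unfolding variance_Ustat sum_diag_term[symmetric] G_def by (simp add: sum_subtractf split_beta)
  then have "ennreal \<bar>variance (Ustat I X H) - 2 * sigma2 M I X H\<bar>
      \<le> (\<Sum>(i, k)\<in>pairs. ennreal \<bar>\<Sum>(j, l)\<in>pairs. G i k j l\<bar>)"
    using ennreal_abs_sum_le[of "\<lambda>(i, k). \<Sum>(j, l)\<in>pairs. G i k j l" pairs] by (simp add: split_beta)
  also have "\<dots> \<le> (\<Sum>(i, k)\<in>pairs. \<Sum>(j, l)\<in>pairs. ennreal \<bar>G i k j l\<bar>)"
    unfolding split_beta by (intro sum_mono ennreal_abs_sum_le)
  also have "\<dots> \<le> 32 * ratio_bound" by (rule sum_G_le)
  finally show ?thesis .
qed

end

text \<open>Eventual square integrability is part of the conclusion because the variance of a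
  function that is not square integrable would be a default value. The difference form of the
  asymptotics avoids dividing by sigma_n^2, which may be 0.\<close>

theorem mainTheorem7:
  fixes M :: "'w measure"
    and I :: "nat \<Rightarrow> 'i set"
    and d :: "nat \<Rightarrow> 'i \<Rightarrow> 'i \<Rightarrow> ereal"
    and X :: "nat \<Rightarrow> 'i \<Rightarrow> 'w \<Rightarrow> real ^ 'd"
    and H :: "nat \<Rightarrow> real ^ 'd \<Rightarrow> real ^ 'd \<Rightarrow> real"
    and beta :: "nat \<Rightarrow> nat \<Rightarrow> real \<Rightarrow> real"
    and m :: "nat \<Rightarrow> real"
    and \<delta> :: real
  assumes P: "prob_space M"
    and I_fin: "\<And>n. finite (I n)" and I_card: "\<And>n. card (I n) = n"
    and X_meas: "\<And>n i. i \<in> I n \<Longrightarrow> X n i \<in> borel_measurable M"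
    \<comment> \<open>d n is a metric on I n with values in [0, infinity]\<close>
    and d_nonneg: "\<And>n i j. i \<in> I n \<Longrightarrow> j \<in> I n \<Longrightarrow> 0 \<le> d n i j"
    and d_refl: "\<And>n i. i \<in> I n \<Longrightarrow> d n i i = 0"
    and d_sym: "\<And>n i j. i \<in> I n \<Longrightarrow> j \<in> I n \<Longrightarrow> d n i j = d n j i"
    and d_tri: "\<And>n i j k. i \<in> I n \<Longrightarrow> j \<in> I n \<Longrightarrow> k \<in> I n \<Longrightarrow> d n i k \<le> d n i j + d n j k"
    \<comment> \<open>Assumption 1\<close>
    and A1: "\<And>n i j. i \<in> I n \<Longrightarrow> j \<in> I n \<Longrightarrow> i \<noteq> j \<Longrightarrow> 1 \<le> d n i j"
    \<comment> \<open>Assumption 2 (beta q1 q2 r plays the role of beta(q1,q2,r) = sup_n beta_n(q1,q2,r))\<close>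
    and A2: "\<And>n I1 I2 q1 q2 r. I1 \<subseteq> I n \<Longrightarrow> I2 \<subseteq> I n \<Longrightarrow> card I1 \<le> q1 \<Longrightarrow> card I2 \<le> q2 \<Longrightarrow>
               ereal r \<le> set_dist (d n) I1 I2 \<Longrightarrow>
               beta_coef M (gen_sigma M (X n) I1) (gen_sigma M (X n) I2) \<le> beta q1 q2 r"
    \<comment> \<open>Assumption 3\<close>
    and H_meas: "\<And>n. (\<lambda>z. H n (fst z) (snd z)) \<in> borel_measurable (borel \<Otimes>\<^sub>M borel)"
    and H_sym: "\<And>n x y. H n x y = H n y x"
    and H_L2: "\<And>n i j. i \<in> I n \<Longrightarrow> j \<in> I n \<Longrightarrow> i \<noteq> j \<Longrightarrow>
               tilde_moment M (X n i) (X n j) (H n) 2 < \<infinity>"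
    \<comment> \<open>degeneracy\<close>
    and degen: "\<And>n. degenerate M (I n) (X n) (H n)"
    and delta_pos: "\<delta> > 0"
    and cond: "\<And>c. c > 0 \<Longrightarrow> eventually (\<lambda>n.
          of_nat (tau (I n) (d n) (m n) [4]) * (Hnorm M (I n) (X n) (H n) 2)\<^sup>2
        + (of_nat (tau (I n) (d n) (m n) [3,1] + tau (I n) (d n) (m n) [2,1,1]
                   + tau (I n) (d n) (m n) [1,1,1,1])
           + of_nat (tau (I n) (d n) (m n) [2,2]))
          * (Hnorm M (I n) (X n) (H n) (2 + \<delta>))\<^sup>2
          * ennreal (max (beta 1 3 (m n)) (max (beta 2 2 (m n)) (beta 3 1 (m n))) powr (\<delta> / (2 + \<delta>)))
        + of_nat (tau (I n) (d n) (m n) [2,2]) * gamma_m1 M (I n) (d n) (X n) (H n) (m n)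
        \<le> ennreal c * ennreal (sigma2 M (I n) (X n) (H n))) sequentially"
  shows "eventually (\<lambda>n. integrable M (\<lambda>\<omega>. (Ustat (I n) (X n) (H n) \<omega>)\<^sup>2)) sequentially
    \<and> (\<lambda>n. prob_space.variance M (Ustat (I n) (X n) (H n)) - 2 * sigma2 M (I n) (X n) (H n))
        \<in> o(\<lambda>n. sigma2 M (I n) (X n) (H n))"
proof -
  \<comment> \<open>The pairs (1, 3), (2, 2) and (3, 1) are all positive q1, q2 with sum 4, so this
    is beta_4(m(n)).\<close>
  define b where "b n = max (beta 1 3 (m n)) (max (beta 2 2 (m n)) (beta 3 1 (m n)))" for n
  have loc: "mixing_ustat M (I n) (d n) (X n) (H n) (m n) (b n) \<delta>" for n
  proof (intro mixing_ustat.intro mixing_ustat_axioms.intro P)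
    fix J1 J2
    assume J: "J1 \<subseteq> I n" "J2 \<subseteq> I n" "card J1 \<le> 1 \<and> card J2 \<le> 3 \<or> card J1 \<le> 2 \<and> card J2 \<le> 2"
      and sep: "ereal (m n) \<le> set_dist (d n) J1 J2"
    from J(3) show "beta_coef M (gen_sigma M (X n) J1) (gen_sigma M (X n) J2) \<le> b n"
    proof
      assume "card J1 \<le> 1 \<and> card J2 \<le> 3"
      then show ?thesis using A2[OF J(1,2) _ _ sep, of 1 3] by (simp add: b_def)
    next
      assume "card J1 \<le> 2 \<and> card J2 \<le> 2"
      then show ?thesis using A2[OF J(1,2) _ _ sep, of 2 2] by (simp add: b_def)
    qed
  qed (use I_fin X_meas d_nonneg d_refl d_sym A1 H_meas H_sym H_L2 degen delta_pos in auto)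
  define R where "R n = mixing_ustat.ratio_bound M (I n) (d n) (X n) (H n) (m n) (b n) \<delta>" for n
  have cond': "\<forall>\<^sub>F n in sequentially. R n \<le> ennreal c * ennreal (sigma2 M (I n) (X n) (H n))" if "c > 0" for c
    using cond[OF that, folded b_def]
    unfolding R_def mixing_ustat.ratio_bound_def[OF loc] mixing_ustat.err_def[OF loc] mult.assoc .
  have sigma2_nonneg: "0 \<le> sigma2 M (I n) (X n) (H n)" for n
    unfolding sigma2_def by (intro sum_nonneg integral_nonneg) auto
  have step: "integrable M (\<lambda>\<omega>. (Ustat (I n) (X n) (H n) \<omega>)\<^sup>2) \<and>
      \<bar>prob_space.variance M (Ustat (I n) (X n) (H n)) - 2 * sigma2 M (I n) (X n) (H n)\<bar>
        \<le> c * sigma2 M (I n) (X n) (H n)"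
    if c: "c > 0" and le: "R n \<le> ennreal (c / 32) * ennreal (sigma2 M (I n) (X n) (H n))" for c n
  proof -
    interpret mixing_ustat M "I n" "d n" "X n" "H n" "m n" "b n" \<delta> by (rule loc)
    \<comment> \<open>The right side of \<open>le\<close> is a product of reals, hence finite. This
      gives access to joint square integrability and so to the second locale, for this
      \<open>n\<close>.\<close>
    have fin: "ratio_bound \<noteq> \<infinity>"
      using le unfolding R_def by (auto simp: top_unique ennreal_mult_eq_top_iff)
    interpret mixing_ustat_L2 M "I n" "d n" "X n" "H n" "m n" "b n" \<delta>
      by unfold_locales (rule joint_L2_of_ratio_bound[OF fin])
    have "ennreal \<bar>variance (Ustat (I n) (X n) (H n)) - 2 * sigma2 M (I n) (X n) (H n)\<bar> \<le> 32 * R n"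
      unfolding R_def by (rule variance_Ustat_bound)
    also have "\<dots> \<le> 32 * (ennreal (c / 32) * ennreal (sigma2 M (I n) (X n) (H n)))"
      using le by (rule mult_left_mono) simp
    also have "\<dots> = ennreal (32 * (c / 32 * sigma2 M (I n) (X n) (H n)))"
      using c by (simp add: ennreal_mult'' ennreal_mult' sigma2_nonneg del: times_divide_eq_left times_divide_eq_right)
    also have "32 * (c / 32 * sigma2 M (I n) (X n) (H n)) = c * sigma2 M (I n) (X n) (H n)" by simp
    finally show ?thesis
      using c sigma2_nonneg[of n] Ustat_square_integrable by (simp add: ennreal_le_iff)
  qed
  have ev: "\<forall>\<^sub>F n in sequentially. integrable M (\<lambda>\<omega>. (Ustat (I n) (X n) (H n) \<omega>)\<^sup>2) \<and>
      \<bar>prob_space.variance M (Ustat (I n) (X n) (H n)) - 2 * sigma2 M (I n) (X n) (H n)\<bar>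
        \<le> c * sigma2 M (I n) (X n) (H n)" if c: "c > 0" for c
  proof -
    \<comment> \<open>Using the hypothesis with c/32 absorbs the constant 32 of the variance
      bound.\<close>
    have "c / 32 > 0" using c by simp
    from cond'[OF this] show ?thesis by eventually_elim (rule step[OF c])
  qed
  show ?thesis
  proof
    show "\<forall>\<^sub>F n in sequentially. integrable M (\<lambda>\<omega>. (Ustat (I n) (X n) (H n) \<omega>)\<^sup>2)"
      using ev[of 1] by (rule eventually_mono) auto
    show "(\<lambda>n. prob_space.variance M (Ustat (I n) (X n) (H n)) - 2 * sigma2 M (I n) (X n) (H n))
        \<in> o(\<lambda>n. sigma2 M (I n) (X n) (H n))"
    proof (rule landau_o.smallI)
      fix c :: real assume "c > 0"
      from ev[OF this] show "\<forall>\<^sub>F n in sequentially.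
          norm (prob_space.variance M (Ustat (I n) (X n) (H n)) - 2 * sigma2 M (I n) (X n) (H n))
          \<le> c * norm (sigma2 M (I n) (X n) (H n))"
        by eventually_elim (simp add: sigma2_nonneg)
    qed
  qed
qed

end
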